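(* There is a constant $C=C(n)>0$, depending only on $n$, such that for all $x_0,x'\in\mathbb R^n$, $r>0$, $a>0$, $b>0$, $T>0$, all $u_0\in C_0^\infty(\mathbb R^n;\mathbb C)$ and all $\varepsilon\in(0,1)$, $$\int_{\mathbb R^n}e^{-b|x-x'|}|u(x,T;u_0)|^2\,dx\le C(x_0,x',r,a,b,T)\Big(\varepsilon\int_{\mathbb R^n}e^{a|x|}|u_0(x)|^2\,dx+\varepsilon e^{\varepsilon^{-1-\frac{Cb^{-1}}{(aT)\wedge r}}}\int_{B_r(x_0)}|u(x,T;u_0)|^2\,dx\Big),$$ where $$C(x_0,x',r,a,b,T)=\exp\Big\{C\Big[1+\frac{|x_0-x'|+r+b^{-1}}{(aT)\wedge r}\Big]\Big\}.$$
   Context: Here $n\in\{1,2,\dots\}$ is fixed. For $u_0\in L^2(\mathbb R^n;\mathbb C)$ and $t\ge 0$, $u(x,t;u_0)=(e^{i\Delta t}u_0)(x)$ denotes the solution of the free Schrödinger equation $i\partial_t u+\Delta u=0$ in $\mathbb R^n\times(0,\infty)$ with $u(x,0)=u_0(x)$. $B_r(x)$ is the closed ball in $\mathbb R^n$ centered at $x$ of radius $r$. $|x|$ is the Euclidean norm and $a\wedge b=\min\{a,b\}$. *)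

theory Defs
  imports "HOL-Analysis.Analysis"
begin

fun continuously_differentiable ::
    "nat \<Rightarrow> ('a::real_normed_vector \<Rightarrow> 'b::real_normed_vector) \<Rightarrow> bool" where
  "continuously_differentiable 0 f \<longleftrightarrow> continuous_on UNIV f"
| "continuously_differentiable (Suc k) f \<longleftrightarrow>
     (\<forall>x. f differentiable (at x)) \<and>
     (\<forall>v. continuously_differentiable k (\<lambda>x. frechet_derivative f (at x) v))"

definition smooth_compact_support :: "(real ^ 'n \<Rightarrow> complex) \<Rightarrow> bool" where
  "smooth_compact_support f \<longleftrightarrow>
     (\<forall>k. continuously_differentiable k f) \<and> compact (closure {x. f x \<noteq> 0})"

definition fourier :: "(real ^ 'n \<Rightarrow> complex) \<Rightarrow> real ^ 'n \<Rightarrow> complex" where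
  "fourier f \<xi> =
     complex_of_real ((2 * pi) powr (- real CARD('n) / 2)) *
     (LINT x|lborel. cis (- (x \<bullet> \<xi>)) * f x)"

definition inverse_fourier :: "(real ^ 'n \<Rightarrow> complex) \<Rightarrow> real ^ 'n \<Rightarrow> complex" where
  "inverse_fourier g x =
     complex_of_real ((2 * pi) powr (- real CARD('n) / 2)) *
     (LINT \<xi>|lborel. cis (x \<bullet> \<xi>) * g \<xi>)"

(* The free propagator as the Fourier multiplier with symbol exp (- i t |xi|^2).
   The integrals are Lebesgue integrals, so this is the usual unitary group on L^2 restricted
   to integrable data with integrable Fourier transform, in particular to test functions;
   for such data it yields the continuous representative of the solution of
   i u_t + Laplacian u = 0 with u(x, 0) = u0 x. *)
definition schrodinger_evolution ::
    "(real ^ 'n \<Rightarrow> complex) \<Rightarrow> real ^ 'n \<Rightarrow> real \<Rightarrow> complex" where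
  "schrodinger_evolution u0 x t =
     inverse_fourier (\<lambda>\<xi>. cis (- t * (norm \<xi>)\<^sup>2) * fourier u0 \<xi>) x"

end

theory Submission
  imports Defs
    "HOL-Complex_Analysis.Riemann_Mapping"
    "HOL-Probability.Characteristic_Functions"
    "HOL-Probability.Sinc_Integral"
begin

text \<open>
  Write $R = (aT) \wedge r$ and $D = 1 + (|x_0 - x'| + r + b^{-1})/R$.

  Completing the square in the propagator kernel shows that, up to a factor of constant modulus,
  $u(x,T)$ is a rescaled Fourier transform of the initial datum:
  $|u(x,T)| = (4\pi T)^{-n/2} |g(x)|$ with $g(x) = \int e^{-i x\cdot y/(2T)} f(y)\,dy$ and
  $f(y) = e^{i|y|^2/(4T)} u_0(y)$ (lemma \<open>schrodinger_evolution_as_scaled_fourier\<close>).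
  The exponential weight on $u_0$ therefore makes $g$ holomorphic and bounded by a constant $A$ on
  the tube $|\mathrm{Im}\,z| < aT/2$, where $A^2$ is controlled by the weighted norm of $u_0$. What
  remains is a quantitative unique continuation problem: $g$ is bounded on a tube and known in
  $L^2$ on a ball.

  Fix a point $x$ with $|y - x| \le \Lambda$ for all $y$ in the ball of radius $r/2$ about $x_0$.
  For each such $y$ the function $h(\zeta) = g(x + \zeta(y - x))$ is holomorphic and bounded by $A$
  on a strip of half-width $H = R/(2\Lambda)$. Its value at $0$ is $g(x)$, and for $s \in [1, 1+H]$
  the point $x + s(y-x)$ still lies in $B_r(x_0)$. Interpolation at $m$ equidistant nodes
  $s_j = 1 + jH/m$ gives
  \[ |h(0)| \le A e^{-m\delta} + 2(3m)^m \sum_j |h(s_j)|, \qquad \delta = e^{-\pi/2 - \pi\Lambda/R} \]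
  (lemma \<open>strip_interpolation_bound\<close>). Here the strip is mapped to the unit disc and the
  Lagrange polynomials are replaced by products of Blaschke factors; these are bounded by $1$ on
  the disc, so the interpolation error, which vanishes at all nodes, is controlled by the Schwarz
  lemma. Squaring and averaging over $y$ turns the right-hand side into an integral over
  $B_r(x_0)$, because each $y \mapsto x + s_j(y - x)$ is a homothety of ratio at least $1$
  (lemma \<open>average_of_homotheties\<close>).

  For the weighted integral put $L = (2/b)\log(1/\varepsilon)$. Outside the ball of radius $L$ about
  $x'$ the bound $|g| \le A$ and half of the weight $e^{-b|x-x'|}$ yield a factor $\varepsilon$.
  Inside it $\Lambda = L + |x_0 - x'| + r$ is admissible, so $\delta^{-1}$ is at most
  $e^{4D} \varepsilon^{-8/(bR)}$, and $m \approx \delta^{-1}\log(1/\varepsilon)$ nodes make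
  $e^{-m\delta}$ small. The price $(3m)^{2m}$ is the double exponential in the theorem.
  The factor $e^{4D}$ inside it cannot be moved into the prefactor directly. If
  $\varepsilon \ge e^{-64D}$, however, the prefactor times $\varepsilon$ is already large enough for the
  supremum bound alone to suffice. If $\varepsilon < e^{-64D}$, then $e^{4D}$ is bounded by a small power
  of $1/\varepsilon$. Absorbing it, the logarithm and the numerical constants is what the summand
  $-1$ in the exponent of $\varepsilon$ is for.
\<close>

section \<open>Interpolation of bounded holomorphic functions\<close>

text \<open>
  Apply the Schwarz lemma after moving \<open>s\<close> to the origin by a Moebius transformation. That lemma
  asks for a strict bound on the function, hence the division by \<open>A + e\<close>.
\<close>

lemma Schwarz_Moebius_bound:
  assumes hol: "f holomorphic_on ball 0 1"
    and bnd: "\<And>z. norm z < 1 \<Longrightarrow> norm (f z) \<le> A"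
    and s: "norm s < 1" "f s = 0" and z: "norm z < 1"
  shows "norm (f z) \<le> A * norm (Moebius_function 0 s z)"
proof (rule field_le_epsilon)
  fix e :: real assume e: "0 < e"
  have A: "0 \<le> A" using order_trans[OF norm_ge_zero bnd[OF s(1)]] .
  define F where "F = (\<lambda>w. f (Moebius_function 0 (- s) w) / of_real (A + e))"
  have s': "norm (- s) < 1" using s by simp
  have into: "Moebius_function 0 (- s) ` ball 0 1 \<subseteq> ball 0 1"
    using Moebius_function_norm_lt_1[OF s'] by auto
  have "(f \<circ> Moebius_function 0 (- s)) holomorphic_on ball 0 1"
    by (rule holomorphic_on_compose_gen[OF Moebius_function_holomorphic[OF s'] hol into])
  then have Fhol: "F holomorphic_on ball 0 1"
    unfolding F_def o_def using A e by (intro holomorphic_intros) (auto simp flip: of_real_add)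
  have F0: "F 0 = 0" using s by (simp add: F_def Moebius_function_of_zero)
  have Fb: "norm (F w) < 1" if "norm w < 1" for w
  proof -
    have "norm (f (Moebius_function 0 (- s) w)) < A + e"
      using bnd[OF Moebius_function_norm_lt_1[OF s' that, of 0]] e by simp
    moreover have "norm (complex_of_real A + complex_of_real e) = A + e"
      using A e by (simp flip: of_real_add)
    ultimately show ?thesis using A e by (simp add: F_def norm_divide)
  qed
  let ?b = "Moebius_function 0 s z"
  have b: "norm ?b < 1" by (rule Moebius_function_norm_lt_1[OF s(1) z])
  have inv: "Moebius_function 0 (- s) ?b = z"
    by (rule Moebius_function_compose) (use s z in auto)
  have "norm (F ?b) \<le> norm ?b"
    using Schwarz_Lemma(1)[OF Fhol F0 Fb b] .
  moreover have "norm (complex_of_real A + complex_of_real e) = A + e"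
      using A e by (simp flip: of_real_add)
  ultimately have "norm (f z) \<le> norm ?b * (A + e)"
    using A e by (simp add: F_def inv norm_divide field_simps)
  also have "\<dots> = A * norm ?b + e * norm ?b" by (simp add: algebra_simps)
  also have "\<dots> \<le> A * norm ?b + e" using b e by (simp add: mult_left_le)
  finally show "norm (f z) \<le> A * norm ?b + e" .
qed

lemma Moebius_denominator_nonzero:
  assumes "norm s < 1" "norm z < (1::real)"
  shows "1 - cnj s * z \<noteq> 0"
proof
  assume "1 - cnj s * z = 0"
  then have "norm (cnj s * z) = 1" by (metis eq_iff_diff_eq_0 norm_one)
  moreover have "norm s * norm z < 1 * 1" using assms by (intro mult_strict_mono') auto
  ultimately show False by (simp add: norm_mult)
qed

lemma Moebius_nonzero:
  assumes "norm s < 1" "norm z < (1::real)" "z \<noteq> s"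
  shows "Moebius_function 0 s z \<noteq> 0"
  using Moebius_denominator_nonzero[OF assms(1,2)] assms(3)
  by (simp add: Moebius_function_simple)

text \<open>
  Zeros are divided out one at a time: by the Schwarz bound, dividing by a Blaschke factor does not
  increase the supremum over the disc.
\<close>

lemma Blaschke_product_bound:
  assumes "finite S" "S \<subseteq> ball 0 1"
    and "f holomorphic_on ball 0 1" "\<And>z. norm z < 1 \<Longrightarrow> norm (f z) \<le> A"
    and "\<And>s. s \<in> S \<Longrightarrow> f s = 0" and z: "norm z < 1"
  shows "norm (f z) \<le> A * (\<Prod>s\<in>S. norm (Moebius_function 0 s z))"
  using assms(1-5)
proof (induction S arbitrary: f rule: finite_induct)
  case empty
  then show ?case using z by simp
next
  case (insert s S)
  have s: "norm s < 1" "f s = 0" using insert.prems by auto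
  define g where "g = (\<lambda>z. (if z = s then deriv f s else (f z - f s) / (z - s)) * (1 - cnj s * z))"
  have "(\<lambda>z. if z = s then deriv f s else (f z - f s) / (z - s)) holomorphic_on ball 0 1"
    by (rule pole_lemma) (use insert.prems s in auto)
  then have ghol: "g holomorphic_on ball 0 1"
    unfolding g_def by (intro holomorphic_intros)
  have fg: "f w = g w * Moebius_function 0 s w" if "norm w < 1" for w
    using Moebius_denominator_nonzero[OF s(1) that] s
    by (auto simp: g_def Moebius_function_simple)
  have gb: "norm (g w) \<le> A" if w: "norm w < 1" "w \<noteq> s" for w
  proof -
    have "norm (g w) * norm (Moebius_function 0 s w) \<le> A * norm (Moebius_function 0 s w)"
      using Schwarz_Moebius_bound[OF insert.prems(2,3) s w(1)] fg[OF w(1)] by (simp add: norm_mult)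
    then show ?thesis using Moebius_nonzero[OF s(1) w] by simp
  qed
  have "norm (g s) \<le> A"
  proof (rule Lim_norm_ubound)
    show "(g \<longlongrightarrow> g s) (at s)"
      using holomorphic_on_imp_continuous_on[OF ghol] s
      by (simp add: continuous_on_eq_continuous_at continuous_at)
    have "eventually (\<lambda>w. w \<in> ball 0 1) (at s)"
      using s by (intro eventually_at_in_open') auto
    moreover have "eventually (\<lambda>w. w \<noteq> s) (at s)" by (simp add: eventually_at_filter)
    ultimately show "eventually (\<lambda>w. norm (g w) \<le> A) (at s)"
      by eventually_elim (auto intro: gb)
  qed auto
  with gb have gb': "norm (g w) \<le> A" if "norm w < 1" for w using that by (cases "w = s") auto
  have "norm (g z) \<le> A * (\<Prod>s\<in>S. norm (Moebius_function 0 s z))"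
  proof (rule insert.IH)
    fix t assume t: "t \<in> S"
    then have "t \<noteq> s" using insert.hyps by auto
    then show "g t = 0" using t insert.prems s by (simp add: g_def)
  qed (use insert.prems ghol gb' in auto)
  then have "norm (f z) \<le> A * (\<Prod>s\<in>S. norm (Moebius_function 0 s z)) * norm (Moebius_function 0 s z)"
    unfolding fg[OF z] norm_mult by (rule mult_right_mono) simp
  then show ?case using insert.hyps by (simp add: mult_ac)
qed

text \<open>
  Lagrange interpolation with Blaschke factors in place of linear factors. The interpolant
  \<open>P\<close> is holomorphic and bounded by the data at the nodes, while \<open>k - P\<close> vanishes at all nodes
  and is therefore small by the product bound. The number \<open>1 / q\<close> is the least pseudo-hyperbolic
  distance between two nodes; it limits the size of the Lagrange basis functions.
\<close>

lemma Blaschke_interpolation_bound: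
  assumes fin: "finite S" and sub: "S \<subseteq> ball 0 1"
    and hol: "k holomorphic_on ball 0 1" and bnd: "\<And>z. norm z < 1 \<Longrightarrow> norm (k z) \<le> A"
    and q: "1 \<le> q"
    and sep: "\<And>s t. s \<in> S \<Longrightarrow> t \<in> S \<Longrightarrow> s \<noteq> t \<Longrightarrow> 1 \<le> q * norm (Moebius_function 0 s t)"
    and z: "norm z < 1"
  shows "norm (k z) \<le> A * (\<Prod>s\<in>S. norm (Moebius_function 0 s z)) + 2 * q ^ card S * (\<Sum>s\<in>S. norm (k s))"
proof -
  define L where "L = (\<lambda>t z. \<Prod>s\<in>S - {t}. Moebius_function 0 s z / Moebius_function 0 s t)"
  define P where "P = (\<lambda>z. \<Sum>t\<in>S. k t * L t z)"
  define Q where "Q = q ^ card S * (\<Sum>s\<in>S. norm (k s))"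
  have L_bound: "norm (L t w) \<le> q ^ card S" if t: "t \<in> S" and w: "norm w < 1" for t w
  proof -
    have "norm (L t w) = (\<Prod>s\<in>S - {t}. norm (Moebius_function 0 s w) / norm (Moebius_function 0 s t))"
      by (simp add: L_def norm_divide flip: prod_norm)
    also have "\<dots> \<le> (\<Prod>s\<in>S - {t}. q)"
    proof (intro prod_mono conjI)
      fix s assume s: "s \<in> S - {t}"
      have s1: "norm s < 1" using s sub by auto
      have t1: "norm t < 1" using t sub by auto
      have "norm (Moebius_function 0 s w) \<le> q * norm (Moebius_function 0 s t)"
        using Moebius_function_norm_lt_1[OF s1 w, of 0] sep[of s t] s t by auto
      then show "norm (Moebius_function 0 s w) / norm (Moebius_function 0 s t) \<le> q"
        using Moebius_nonzero[OF s1 t1] s q by (auto simp: divide_le_eq)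
    qed auto
    also have "\<dots> = q ^ card (S - {t})" by simp
    also have "\<dots> \<le> q ^ card S" by (intro power_increasing card_mono q fin) auto
    finally show ?thesis .
  qed
  have L_diag: "L t t = 1" if "t \<in> S" for t
    unfolding L_def
  proof (rule prod.neutral, intro ballI)
    fix s assume s: "s \<in> S - {t}"
    have "norm s < 1" "norm t < 1" using s that sub by auto
    then show "Moebius_function 0 s t / Moebius_function 0 s t = 1"
      using s Moebius_nonzero[of s t] by auto
  qed
  have L_off: "L t s = 0" if "t \<in> S" "s \<in> S" "s \<noteq> t" for s t
  proof -
    have "s \<in> S - {t}" "Moebius_function 0 s s / Moebius_function 0 s t = 0"
      using that by (auto simp: Moebius_function_eq_zero)
    then show ?thesis unfolding L_def using fin by (intro prod_zero) auto
  qed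
  have P_node: "P s = k s" if "s \<in> S" for s
  proof -
    have "P s = (\<Sum>t\<in>S. if t = s then k s else 0)"
      unfolding P_def by (rule sum.cong) (use L_diag L_off that in auto)
    then show ?thesis using fin that by simp
  qed
  have P_bound: "norm (P w) \<le> Q" if w: "norm w < 1" for w
  proof -
    have "norm (P w) \<le> (\<Sum>t\<in>S. norm (k t) * norm (L t w))"
      unfolding P_def by (rule order_trans[OF norm_sum]) (simp add: norm_mult)
    also have "\<dots> \<le> (\<Sum>t\<in>S. norm (k t) * q ^ card S)"
      by (intro sum_mono mult_left_mono L_bound w) auto
    finally show ?thesis by (simp add: Q_def sum_distrib_left mult_ac)
  qed
  have P_hol: "P holomorphic_on ball 0 1"
    unfolding P_def L_def using sub
    by (intro holomorphic_intros Moebius_function_holomorphic)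
       (auto simp: Moebius_nonzero subset_iff)
  let ?B = "\<Prod>s\<in>S. norm (Moebius_function 0 s z)"
  have B: "0 \<le> ?B" "?B \<le> 1"
    using sub z by (auto intro!: prod_nonneg prod_le_1 less_imp_le[OF Moebius_function_norm_lt_1])
  have Q0: "0 \<le> Q" using order_trans[OF norm_ge_zero P_bound[OF z]] .
  have "norm (k z - P z) \<le> (A + Q) * ?B"
  proof (rule Blaschke_product_bound[OF fin sub _ _ _ z, where f = "\<lambda>z. k z - P z"])
    show "norm (k w - P w) \<le> A + Q" if "norm w < 1" for w
      using norm_triangle_ineq4[of "k w" "P w"] bnd[OF that] P_bound[OF that] by linarith
  qed (use hol P_hol P_node in \<open>auto intro: holomorphic_intros\<close>)
  also have "\<dots> \<le> A * ?B + Q" using B Q0 by (simp add: algebra_simps mult_left_le)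
  finally have "norm (k z) \<le> A * ?B + Q + Q"
    using norm_triangle_sub[of "k z" "P z"] P_bound[OF z] by linarith
  then show ?thesis by (simp add: Q_def)
qed

lemma tanh_real_exp:
  fixes v :: real
  shows "tanh v = 1 - 2 / (exp (2 * v) + 1)"
proof -
  have "(1 - 1 / E) / (1 + 1 / E) = 1 - 2 / (E + 1)" if "0 < E" for E :: real
  proof -
    have "(1 - 1 / E) / (1 + 1 / E) = ((E - 1) / E) / ((E + 1) / E)"
      using that by (simp add: diff_divide_distrib add_divide_distrib)
    also have "\<dots> = (E - 1) / (E + 1)" using that by simp
    also have "\<dots> = 1 - 2 / (E + 1)" using that by (simp add: field_simps)
    finally show ?thesis .
  qed
  from this[of "exp (2 * v)"] show ?thesis
    by (simp add: tanh_real_altdef exp_minus inverse_eq_divide)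
qed

lemma tanh_real_lower:
  fixes v :: real assumes "0 \<le> v" "v \<le> 1"
  shows "v / 2 \<le> tanh v"
proof -
  have e: "1 + 2 * v \<le> exp (2 * v)" using exp_ge_add_one_self[of "2 * v"] by simp
  have "exp (2 * v) + 1 \<noteq> 0" using exp_gt_zero[of "2 * v"] by linarith
  then have "tanh v = (exp (2 * v) - 1) / (exp (2 * v) + 1)"
    by (simp add: tanh_real_exp field_simps)
  moreover have "v / 2 * (exp (2 * v) + 1) \<le> exp (2 * v) - 1"
  proof -
    have "(2 - v) * (1 + 2 * v) \<le> (2 - v) * exp (2 * v)" using e assms by (intro mult_left_mono) auto
    moreover have "v * v \<le> v * 1" using assms by (intro mult_left_mono) auto
    ultimately show ?thesis by (simp add: algebra_simps)
  qed
  ultimately show ?thesis by (simp add: le_divide_eq add_pos_pos)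
qed

lemma tanh_real_upper:
  fixes v :: real assumes "0 \<le> v"
  shows "tanh v \<le> 1 - exp (- 2 * v)"
proof -
  have e: "1 \<le> exp (2 * v)" using assms by simp
  have "1 / exp (2 * v) \<le> 2 / (exp (2 * v) + 1)"
    using e by (simp add: field_simps add_pos_pos)
  then show ?thesis by (simp add: tanh_real_exp exp_minus inverse_eq_divide)
qed

text \<open>
  The hyperbolic tangent carries the additive structure of the real line to the hyperbolic
  structure of the interval from -1 to 1, so equidistant points become pseudo-hyperbolically
  equidistant points.
\<close>

lemma Moebius_tanh:
  "Moebius_function 0 (of_real (tanh u)) (of_real (tanh v)) = of_real (tanh (v - u :: real))"
proof -
  have "tanh (v + (- u)) = (tanh v + tanh (- u)) / (1 + tanh v * tanh (- u))"
    by (rule tanh_add) (auto simp: less_imp_neq[symmetric] cosh_real_pos)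
  then have "tanh (v - u) = (tanh v - tanh u) / (1 - tanh u * tanh v)"
    by (simp add: mult.commute)
  then show ?thesis by (simp add: Moebius_function_simple)
qed

text \<open>
  The conformal map \<open>(2 * H / pi) * Ln ((1 + w) / (1 - w))\<close> takes the unit disc to the strip
  and the real point \<open>tanh (pi * s / (4 * H))\<close> to \<open>s\<close>. The \<open>m\<close> nodes fill an interval of bounded
  hyperbolic length, so their mutual distances are at least \<open>1 / (3 * m)\<close>. Their distance
  from the unit circle, which governs the Blaschke product at the origin, is at least
  \<open>exp (- pi / 2 - pi / (2 * H))\<close>.
\<close>

lemma strip_interpolation_bound:
  fixes H A :: real and m :: nat and h :: "complex \<Rightarrow> complex"
  assumes H: "0 < H" and m: "1 \<le> m"
    and hol: "h holomorphic_on {z. \<bar>Im z\<bar> < H}"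
    and bnd: "\<And>z. \<bar>Im z\<bar> < H \<Longrightarrow> norm (h z) \<le> A"
  shows "norm (h 0) \<le> A * exp (- (real m * exp (- pi / 2 - pi / (2 * H))))
     + 2 * (3 * real m) ^ m * (\<Sum>j=1..m. norm (h (of_real (1 + H * real j / real m))))"
proof -
  define \<phi> where "\<phi> = (\<lambda>w::complex. of_real (2 * H / pi) * Ln ((1 + w) / (1 - w)))"
  define u where "u = (\<lambda>j::nat. pi / (4 * H) * (1 + H * real j / real m))"
  define w where "w = (\<lambda>j. complex_of_real (tanh (u j)))"
  define \<delta> where "\<delta> = exp (- pi / 2 - pi / (2 * H))"
  have Re_pos: "0 < Re ((1 + z) / (1 - z))" if z: "norm z < 1" for z :: complex
  proof -
    have "z \<noteq> 1" using z by auto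
    then have n: "(1 - Re z)\<^sup>2 + (Im z)\<^sup>2 > 0"
      by (metis complex_eq_iff diff_eq_eq eq_iff_diff_eq_0 one_complex.simps sum_power2_gt_zero_iff add_0)
    have "(Re z)\<^sup>2 + (Im z)\<^sup>2 < 1"
      using z by (simp add: cmod_def)
    then show ?thesis using n
      by (simp add: Re_divide power2_eq_square algebra_simps)
  qed
  have ne1: "1 - z \<noteq> 0" if "norm z < 1" for z :: complex using that by auto
  have phi_hol: "\<phi> holomorphic_on ball 0 1"
    unfolding \<phi>_def
  proof (intro holomorphic_intros)
    fix z :: complex assume "z \<in> ball 0 1"
    then show "(1 + z) / (1 - z) \<notin> \<real>\<^sub>\<le>\<^sub>0" and "1 - z \<noteq> 0"
      using Re_pos[of z] ne1[of z] by (auto simp: complex_nonpos_Reals_iff)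
  qed
  have phi_strip: "\<bar>Im (\<phi> z)\<bar> < H" if z: "norm z < 1" for z
  proof -
    have "(1 + z) / (1 - z) \<noteq> 0" using Re_pos[OF z] by auto
    then have "\<bar>Im (Ln ((1 + z) / (1 - z)))\<bar> < pi / 2"
      using Re_Ln_pos_lt Re_pos[OF z] by blast
    then have "2 * H / pi * \<bar>Im (Ln ((1 + z) / (1 - z)))\<bar> < 2 * H / pi * (pi / 2)"
      using H by (intro mult_strict_left_mono) auto
    also have "2 * H / pi * (pi / 2) = H" by simp
    finally show ?thesis using H by (simp add: \<phi>_def abs_mult)
  qed
  have phi_tanh: "\<phi> (of_real (tanh v)) = of_real (4 * H / pi * v)" for v :: real
  proof -
    have "(1 + (1 - 2 / (E + 1))) / (1 - (1 - 2 / (E + 1))) = E" if "0 < E" for E :: real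
      using that by (simp add: field_simps)
    then have "(1 + tanh v) / (1 - tanh v) = exp (2 * v)"
      by (simp add: tanh_real_exp)
    then have "(1 + complex_of_real (tanh v)) / (1 - of_real (tanh v)) = of_real (exp (2 * v))"
      by (metis of_real_1 of_real_add of_real_diff of_real_divide)
    then have "Ln ((1 + complex_of_real (tanh v)) / (1 - of_real (tanh v))) = of_real (2 * v)"
      by (metis Ln_of_real exp_gt_zero ln_exp)
    then show ?thesis by (simp add: \<phi>_def)
  qed
  have phi_0: "\<phi> 0 = 0" using phi_tanh[of 0] by simp
  have phi_w: "\<phi> (w j) = of_real (1 + H * real j / real m)" for j
    using H unfolding w_def phi_tanh u_def by simp
  have u_diff: "u i - u j = pi / 4 * (real i - real j) / real m" for i j
    using H m by (simp add: u_def field_simps)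
  have w1: "norm (w j) < 1" for j
    using tanh_real_bounds[of "u j"] by (auto simp: w_def)
  have sep: "1 \<le> 3 * real m * norm (Moebius_function 0 (w i) (w j))"
    if ij: "i \<in> {1..m}" "j \<in> {1..m}" "i \<noteq> j" for i j
  proof -
    define v where "v = \<bar>u j - u i\<bar>"
    have d: "1 \<le> \<bar>real j - real i\<bar>" "\<bar>real j - real i\<bar> \<le> real m" using ij by auto
    have v: "v = pi / 4 * \<bar>real j - real i\<bar> / real m"
      unfolding v_def u_diff by (simp add: abs_mult)
    have "v \<le> pi / 4 * real m / real m"
      unfolding v using d by (intro divide_right_mono mult_left_mono) auto
    then have v1: "v \<le> 1" using m pi_less_4 by simp
    \<comment> \<open>The separation \<open>1 / (3 * m)\<close> follows from \<open>pi > 3\<close> and \<open>tanh v \<ge> v / 2\<close>.\<close>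
    have "3 / 4 * 1 / real m \<le> v" unfolding v
      using d pi_gt3 by (intro divide_right_mono mult_mono) auto
    then have "3 / (8 * real m) \<le> tanh v" using tanh_real_lower[OF _ v1] v_def by force
    also have "tanh v = norm (Moebius_function 0 (w i) (w j))"
      unfolding w_def Moebius_tanh v_def by (simp add: abs_if flip: tanh_minus)
    finally have "3 * real m * (3 / (8 * real m)) \<le> 3 * real m * norm (Moebius_function 0 (w i) (w j))"
      by (intro mult_left_mono) auto
    then show ?thesis using m by simp
  qed
  have inj: "inj_on w {1..m}"
    using sep Moebius_function_eq_zero[of 0] by (force simp: inj_on_def)
  define S where "S = w ` {1..m}"
  have card: "card S = m" using inj by (simp add: S_def card_image)
  have "norm ((h \<circ> \<phi>) 0) \<le> A * (\<Prod>s\<in>S. norm (Moebius_function 0 s 0)) + 2 * (3 * real m) ^ card S * (\<Sum>s\<in>S. norm ((h \<circ> \<phi>) s))"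
  proof (rule Blaschke_interpolation_bound)
    show "(h \<circ> \<phi>) holomorphic_on ball 0 1"
      by (rule holomorphic_on_compose_gen[OF phi_hol hol]) (auto simp: phi_strip)
    show "1 \<le> 3 * real m * norm (Moebius_function 0 s t)" if "s \<in> S" "t \<in> S" "s \<noteq> t" for s t
      using that sep unfolding S_def by blast
  qed (use w1 bnd phi_strip m in \<open>auto simp: S_def\<close>)
  also have "(\<Sum>s\<in>S. norm ((h \<circ> \<phi>) s)) = (\<Sum>j=1..m. norm (h (of_real (1 + H * real j / real m))))"
    unfolding S_def using inj by (subst sum.reindex) (auto simp: phi_w)
  also have "(\<Prod>s\<in>S. norm (Moebius_function 0 s 0)) = (\<Prod>j=1..m. norm (w j))"
    unfolding S_def using inj by (subst prod.reindex) (auto simp: Moebius_function_of_zero)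
  finally have main: "norm (h 0) \<le> A * (\<Prod>j=1..m. norm (w j)) +
     2 * (3 * real m) ^ m * (\<Sum>j=1..m. norm (h (of_real (1 + H * real j / real m))))"
    by (simp add: phi_0 card)
  have "(\<Prod>j=1..m. norm (w j)) \<le> (\<Prod>j=1..m. exp (- \<delta>))"
  proof (intro prod_mono conjI)
    fix j assume j: "j \<in> {1..m}"
    have u0: "0 \<le> u j" using H by (simp add: u_def)
    have "u j \<le> pi / (4 * H) * (1 + H * 1)"
      unfolding u_def using j H m by (intro mult_left_mono add_left_mono) (auto simp: field_simps)
    also have "\<dots> = (pi / 2 + pi / (2 * H)) / 2" using H by (simp add: field_simps)
    finally have "\<delta> \<le> exp (- 2 * u j)" by (simp add: \<delta>_def)
    then have "tanh (u j) \<le> 1 - \<delta>" using tanh_real_upper[OF u0] by linarith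
    also have "\<dots> \<le> exp (- \<delta>)" using exp_ge_add_one_self[of "- \<delta>"] by simp
    finally show "norm (w j) \<le> exp (- \<delta>)" using u0 by (simp add: w_def)
  qed auto
  also have "\<dots> = exp (- (real m * \<delta>))" by (simp flip: exp_of_nat_mult)
  finally have "A * (\<Prod>j=1..m. norm (w j)) \<le> A * exp (- (real m * \<delta>))"
    using order_trans[OF norm_ge_zero bnd[of 0]] H by (intro mult_left_mono) auto
  with main show ?thesis unfolding \<delta>_def by linarith
qed

section \<open>Holomorphic parameter integrals and complex Gaussians\<close>

text \<open>
  Differentiation under the integral sign. A local integrable bound on the integrand is enough,
  because Cauchy's inequality turns it into a bound on the derivative and hence on the difference
  quotients.
\<close>

lemma holomorphic_on_integral_parameter:
  fixes F :: "complex \<Rightarrow> 'a \<Rightarrow> complex"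
  assumes hol: "\<And>x. x \<in> space M \<Longrightarrow> (\<lambda>z. F z x) holomorphic_on U"
    and meas: "\<And>z. z \<in> U \<Longrightarrow> F z \<in> borel_measurable M"
    and dom: "\<And>z0. z0 \<in> U \<Longrightarrow> \<exists>\<rho>>0. \<exists>w. integrable M w \<and> ball z0 \<rho> \<subseteq> U \<and>
                (\<forall>z\<in>ball z0 \<rho>. \<forall>x\<in>space M. norm (F z x) \<le> w x)"
  shows "(\<lambda>z. \<integral>x. F z x \<partial>M) holomorphic_on U"
proof (rule holomorphic_onI)
  fix z0 assume "z0 \<in> U"
  from dom[OF this] obtain \<rho> w where \<rho>: "0 < \<rho>" and w: "integrable M w" and sub: "ball z0 \<rho> \<subseteq> U"
    and bnd: "\<And>z x. z \<in> ball z0 \<rho> \<Longrightarrow> x \<in> space M \<Longrightarrow> norm (F z x) \<le> w x" by blast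
  define G where "G = (\<lambda>z. \<integral>x. F z x \<partial>M)"
  define B where "B = ball z0 (\<rho> / 2)"
  have B: "B \<subseteq> ball z0 \<rho>" "open B" "convex B" "z0 \<in> B" using \<rho> by (auto simp: B_def)
  have intF: "integrable M (F z)" if "z \<in> ball z0 \<rho>" for z
    by (rule Bochner_Integration.integrable_bound[OF w meas]) (use that sub bnd in \<open>fastforce intro: order_trans\<close>)+
  have der: "((\<lambda>z. F z x) has_field_derivative deriv (\<lambda>z. F z x) z) (at z)"
    if "z \<in> ball z0 \<rho>" "x \<in> space M" for z x
    by (rule holomorphic_derivI[OF holomorphic_on_subset[OF hol[OF that(2)] sub] _ that(1)]) auto
  have derb: "norm (deriv (\<lambda>z. F z x) z) \<le> 4 * w x / \<rho>" if z: "z \<in> B" and x: "x \<in> space M" for z x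
  proof -
    have c: "cball z (\<rho> / 4) \<subseteq> ball z0 \<rho>"
    proof
      fix y assume "y \<in> cball z (\<rho> / 4)"
      then have "dist z0 z < \<rho> / 2" "dist z y \<le> \<rho> / 4" using z by (auto simp: B_def)
      then have "dist z0 y < \<rho>" using dist_triangle[of z0 y z] \<rho> by linarith
      then show "y \<in> ball z0 \<rho>" by simp
    qed
    then have h: "(\<lambda>z. F z x) holomorphic_on cball z (\<rho> / 4)"
      using holomorphic_on_subset[OF hol[OF x]] sub by blast
    have "norm ((deriv ^^ 1) (\<lambda>z. F z x) z) \<le> fact 1 * w x / (\<rho> / 4) ^ 1"
    proof (rule Cauchy_inequality)
      fix y assume "norm (z - y) = \<rho> / 4"
      then have "y \<in> cball z (\<rho> / 4)" by (simp add: dist_norm)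
      with c show "norm (F y x) \<le> w x" using bnd x by blast
    qed (use h \<rho> in \<open>auto intro: holomorphic_on_subset holomorphic_on_imp_continuous_on\<close>)
    then show ?thesis by (simp add: mult.commute)
  qed
  have lip: "norm ((F z x - F z0 x) / (z - z0)) \<le> 4 * w x / \<rho>" if z: "z \<in> B - {z0}" and x: "x \<in> space M" for z x
  proof -
    have "norm (F z x - F z0 x) \<le> 4 * w x / \<rho> * norm (z - z0)"
      by (rule field_differentiable_bound[OF B(3), where f' = "deriv (\<lambda>z. F z x)"])
         (use has_field_derivative_at_within[OF der[OF subsetD[OF B(1)] x]] derb z x B in auto)
    then show ?thesis using z by (simp add: norm_divide divide_le_eq)
  qed
  have "((\<lambda>z. (G z - G z0) / (z - z0)) \<longlongrightarrow> (\<integral>x. deriv (\<lambda>z. F z x) z0 \<partial>M)) (at z0 within B)"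
    unfolding tendsto_at_iff_sequentially
  proof (intro allI impI)
    fix X assume X: "\<forall>i. X i \<in> B - {z0}" "X \<longlonglongrightarrow> z0"
    have lim: "(\<lambda>i. (F (X i) x - F z0 x) / (X i - z0)) \<longlonglongrightarrow> deriv (\<lambda>z. F z x) z0"
      if x: "x \<in> space M" for x
    proof -
      have "((\<lambda>z. (F z x - F z0 x) / (z - z0)) \<longlongrightarrow> deriv (\<lambda>z. F z x) z0) (at z0)"
        using der[of z0 x] x \<rho> by (simp add: has_field_derivative_iff)
      then show ?thesis using X
        unfolding tendsto_at_iff_sequentially by (auto simp: o_def)
    qed
    have measq: "(\<lambda>x. (F (X i) x - F z0 x) / (X i - z0)) \<in> borel_measurable M" for i
      using meas[of "X i"] meas[OF \<open>z0 \<in> U\<close>] X(1) B sub by (intro borel_measurable_divide borel_measurable_diff borel_measurable_const) auto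
    have "(\<lambda>i. \<integral>x. (F (X i) x - F z0 x) / (X i - z0) \<partial>M) \<longlonglongrightarrow> (\<integral>x. deriv (\<lambda>z. F z x) z0 \<partial>M)"
    proof (rule integral_dominated_convergence)
      show "integrable M (\<lambda>x. 4 * w x / \<rho>)" using w by simp
      show "(\<lambda>x. deriv (\<lambda>z. F z x) z0) \<in> borel_measurable M"
        using measq lim by (rule borel_measurable_LIMSEQ_metric)
    qed (use measq lim lip X in auto)
    moreover have "(\<integral>x. (F (X i) x - F z0 x) / (X i - z0) \<partial>M) = (G (X i) - G z0) / (X i - z0)" for i
    proof -
      have "X i \<in> ball z0 \<rho>" "z0 \<in> ball z0 \<rho>" using X(1) B \<rho> by auto
      then show ?thesis
        unfolding G_def integral_divide_zero by (simp add: intF Bochner_Integration.integral_diff)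
    qed
    ultimately show "((\<lambda>z. (G z - G z0) / (z - z0)) \<circ> X) \<longlonglongrightarrow> (\<integral>x. deriv (\<lambda>z. F z x) z0 \<partial>M)"
      by (simp only: o_def)
  qed
  then have "(G has_field_derivative (\<integral>x. deriv (\<lambda>z. F z x) z0 \<partial>M)) (at z0)"
    unfolding has_field_derivative_iff at_within_open[OF B(4,2)] .
  then show "(\<lambda>z. \<integral>x. F z x \<partial>M) field_differentiable at z0 within U"
    unfolding G_def[symmetric]
    using field_differentiable_at_within field_differentiable_def by blast
qed

lemma integrable_gaussian_real:
  fixes k :: real assumes "0 < k"
  shows "integrable lborel (\<lambda>x::real. exp (- k * x\<^sup>2))"
proof -
  define \<sigma> where "\<sigma> = sqrt (1 / (2 * k))"
  have \<sigma>: "0 < \<sigma>" "\<sigma>\<^sup>2 = 1 / (2 * k)" using assms by (auto simp: \<sigma>_def)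
  have "integrable lborel (\<lambda>x. sqrt (2 * pi * \<sigma>\<^sup>2) * normal_density 0 \<sigma> x)"
    using \<sigma> by (intro integrable_mult_right integrable_normal_density) auto
  also have "(\<lambda>x. sqrt (2 * pi * \<sigma>\<^sup>2) * normal_density 0 \<sigma> x) = (\<lambda>x. exp (- k * x\<^sup>2))"
    using \<sigma> assms by (auto simp: normal_density_def fun_eq_iff field_simps)
  finally show ?thesis .
qed

lemma fourier_gaussian_real_width:
  fixes l s :: real assumes l: "0 < l"
  shows "(LINT x|lborel. exp (\<i> * of_real (s * x) - of_real l * of_real (x\<^sup>2))) =
     csqrt (of_real pi / of_real l) * exp (- of_real (s\<^sup>2) / (4 * of_real l))"
proof -
  define c where "c = sqrt (2 * l)"
  have c: "0 < c" "c\<^sup>2 = 2 * l" using l by (auto simp: c_def)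
  have "complex_of_real (exp (- ((s / c)\<^sup>2) / 2)) = (CLINT x|std_normal_distribution. iexp (s / c * x))"
    using fun_cong[OF char_std_normal_distribution, of "s / c"] by (simp add: char_def)
  also have "\<dots> = (CLINT x|lborel. std_normal_density x *\<^sub>R iexp (s / c * x))"
    by (subst integral_density) auto
  also have "\<dots> = c *\<^sub>R (CLINT x|lborel. std_normal_density (c * x) *\<^sub>R iexp (s / c * (c * x)))"
    using c by (subst lborel_integral_real_affine[where c = c and t = 0]) auto
  also have "(\<lambda>x. std_normal_density (c * x) *\<^sub>R iexp (s / c * (c * x))) =
     (\<lambda>x. complex_of_real (1 / sqrt (2 * pi)) * exp (\<i> * of_real (s * x) - of_real l * of_real (x\<^sup>2)))"
  proof
    fix x :: real
    have "(c * x)\<^sup>2 / 2 = l * x\<^sup>2" using c by (simp add: power_mult_distrib)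
    then have d: "std_normal_density (c * x) = 1 / sqrt (2 * pi) * exp (- (l * x\<^sup>2))"
      by (simp add: std_normal_density_def)
    have e: "exp (\<i> * of_real (s * x) - of_real l * of_real (x\<^sup>2)) = complex_of_real (exp (- (l * x\<^sup>2))) * iexp (s * x)"
      by (simp flip: exp_of_real exp_add)
    have "s / c * (c * x) = s * x" using c by simp
    then show "std_normal_density (c * x) *\<^sub>R iexp (s / c * (c * x)) =
       complex_of_real (1 / sqrt (2 * pi)) * exp (\<i> * of_real (s * x) - of_real l * of_real (x\<^sup>2))"
      unfolding d e by (simp only: scaleR_conv_of_real of_real_mult mult.assoc)
  qed
  finally have "of_real (exp (- ((s / c)\<^sup>2) / 2)) = complex_of_real (c / sqrt (2 * pi)) *
     (LINT x|lborel. exp (\<i> * of_real (s * x) - of_real l * of_real (x\<^sup>2)))"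
    by (simp add: scaleR_conv_of_real)
  moreover have "complex_of_real (sqrt (pi / l)) * complex_of_real (c / sqrt (2 * pi)) = 1"
    using l by (simp add: c_def real_sqrt_divide real_sqrt_mult flip: of_real_mult)
  ultimately have "(LINT x|lborel. exp (\<i> * of_real (s * x) - of_real l * of_real (x\<^sup>2))) =
     complex_of_real (sqrt (pi / l)) * of_real (exp (- ((s / c)\<^sup>2) / 2))"
    by (metis (no_types, lifting) mult.assoc mult_1)
  also have "(s / c)\<^sup>2 / 2 = s\<^sup>2 / (4 * l)" using c by (simp add: power_divide)
  then have "- ((s / c)\<^sup>2) / 2 = - (s\<^sup>2) / (4 * l)" by simp
  also have "complex_of_real (sqrt (pi / l)) = csqrt (of_real pi / of_real l)"
    using l by (metis of_real_divide csqrt_of_real_nonneg divide_nonneg_pos pi_ge_zero Re_complex_of_real Im_complex_of_real of_real_sqrt)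
  finally show ?thesis by (simp flip: exp_of_real)
qed

text \<open>
  For positive real \<open>\<mu>\<close> this is the characteristic function of the normal distribution. Both sides are
  holomorphic in \<open>\<mu>\<close> on the right half-plane, so they agree there.
\<close>

lemma fourier_gaussian_complex_width:
  fixes \<mu> :: complex and s :: real
  assumes \<mu>: "0 < Re \<mu>"
  shows "(LINT x|lborel. exp (\<i> * of_real (s * x) - \<mu> * of_real (x\<^sup>2))) =
     csqrt (of_real pi / \<mu>) * exp (- of_real (s\<^sup>2) / (4 * \<mu>))"
proof -
  let ?F = "\<lambda>\<mu> x. exp (\<i> * of_real (s * x) - \<mu> * of_real (x\<^sup>2))"
  let ?R = "\<lambda>\<mu>. csqrt (of_real pi / \<mu>) * exp (- of_real (s\<^sup>2) / (4 * \<mu>))"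
  let ?U = "{z. 0 < Re z}"
  have nF: "norm (?F z x) = exp (- Re z * x\<^sup>2)" for z x by simp
  have L: "(\<lambda>\<mu>. LINT x|lborel. ?F \<mu> x) holomorphic_on ?U"
  proof (rule holomorphic_on_integral_parameter)
    fix z0 :: complex assume z0: "z0 \<in> ?U"
    have near: "Re z0 / 2 < Re z" if "z \<in> ball z0 (Re z0 / 2)" for z
    proof -
      have "\<bar>Re (z0 - z)\<bar> < Re z0 / 2"
        using that abs_Re_le_cmod[of "z0 - z"] by (simp add: dist_norm)
      then have "\<bar>Re z0 - Re z\<bar> < Re z0 / 2" by simp
      then show ?thesis unfolding abs_if by (auto split: if_splits)
    qed
    show "\<exists>\<rho>>0. \<exists>w. integrable lborel w \<and> ball z0 \<rho> \<subseteq> ?U \<and>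
       (\<forall>z\<in>ball z0 \<rho>. \<forall>x\<in>space lborel. norm (?F z x) \<le> w x)"
    proof (intro exI conjI ballI)
      show "0 < Re z0 / 2" using z0 by simp
      show "integrable lborel (\<lambda>x::real. exp (- (Re z0 / 2) * x\<^sup>2))"
        using z0 by (intro integrable_gaussian_real) simp
      show "ball z0 (Re z0 / 2) \<subseteq> ?U"
      proof
        fix z assume "z \<in> ball z0 (Re z0 / 2)"
        from near[OF this] z0 show "z \<in> ?U" by simp
      qed
      fix z x assume "z \<in> ball z0 (Re z0 / 2)"
      from less_imp_le[OF near[OF this]] show "norm (?F z x) \<le> exp (- (Re z0 / 2) * x\<^sup>2)"
        unfolding nF exp_le_cancel_iff by (intro mult_right_mono) auto
    qed
  qed (auto intro!: holomorphic_intros)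
  have Re_inv: "0 < Re (of_real pi / z)" if "0 < Re z" for z
  proof -
    have "z \<noteq> 0" using that by auto
    then show ?thesis using that by (simp add: Re_divide sum_power2_gt_zero_iff complex_eq_iff)
  qed
  have ne: "of_real pi / z \<notin> \<real>\<^sub>\<le>\<^sub>0" "z \<noteq> 0" if "z \<in> ?U" for z
    using Re_inv[of z] that by (auto simp: complex_nonpos_Reals_iff)
  have R: "?R holomorphic_on ?U"
    by (intro holomorphic_intros) (use ne in auto)
  have lim: "1 islimpt (complex_of_real ` {0<..})"
  proof -
    show ?thesis
      unfolding islimpt_approachable
    proof (intro allI impI)
      fix e :: real assume "0 < e"
      then show "\<exists>x'\<in>complex_of_real ` {0<..}. x' \<noteq> 1 \<and> dist x' 1 < e"
        by (intro bexI[of _ "complex_of_real (1 + e / 2)"] imageI) (auto simp: dist_norm)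
    qed
  qed
  have "(LINT x|lborel. ?F \<mu> x) - ?R \<mu> = 0"
  proof (rule analytic_continuation[where f = "\<lambda>\<mu>. (LINT x|lborel. ?F \<mu> x) - ?R \<mu>" and S = ?U and U = "complex_of_real ` {0<..}" and \<xi> = 1])
    show "(\<lambda>\<mu>. (LINT x|lborel. ?F \<mu> x) - ?R \<mu>) holomorphic_on ?U"
      by (intro holomorphic_on_diff L R)
    show "open ?U" by (rule open_halfspace_Re_gt)
    show "connected ?U" by (intro convex_connected convex_halfspace_Re_gt)
    fix z assume "z \<in> complex_of_real ` {0<..}"
    then obtain l where "z = of_real l" "0 < l" by auto
    then show "(LINT x|lborel. ?F z x) - ?R z = 0"
      using fourier_gaussian_real_width[of l s] by simp
  qed (use lim \<mu> in auto)
  then show ?thesis by simp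
qed

text \<open>
  Up to the choice of coordinates, \<open>lborel\<close> is the product of one-dimensional Lebesgue measures over the
  basis, so integrals of products of functions of one coordinate factorise.
\<close>

lemma lborel_product_integral:
  fixes f :: "'a::euclidean_space \<Rightarrow> real \<Rightarrow> 'b::{real_normed_field,banach,second_countable_topology}"
  assumes int: "\<And>b. b \<in> Basis \<Longrightarrow> integrable lborel (f b)"
  shows integrable_lborel_product: "integrable lborel (\<lambda>x::'a. \<Prod>b\<in>Basis. f b (x \<bullet> b))"
    and integral_lborel_product: "(LINT x|lborel. (\<Prod>b\<in>Basis. f b (x \<bullet> b))) = (\<Prod>b\<in>Basis. (LINT t|lborel. f b t))"
proof -
  interpret P: product_sigma_finite "\<lambda>_::'a. lborel :: real measure" ..
  let ?P = "Pi\<^sub>M (Basis::'a set) (\<lambda>_. lborel :: real measure)"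
  let ?T = "\<lambda>y::'a \<Rightarrow> real. \<Sum>b\<in>Basis. y b *\<^sub>R b"
  have T: "?T \<in> measurable ?P borel" by measurable
  have [measurable]: "f b \<in> borel_measurable borel" if "b \<in> Basis" for b
    using borel_measurable_integrable[OF int[OF that]] by simp
  have m: "(\<lambda>x::'a. \<Prod>b\<in>Basis. f b (x \<bullet> b)) \<in> borel_measurable borel"
    by (rule borel_measurable_prod) measurable
  have coord: "?T y \<bullet> b = y b" if "b \<in> Basis" for y b
    using that by (simp add: inner_sum_left inner_Basis if_distrib cong: if_cong)
  have comp: "(\<lambda>y. \<Prod>b\<in>Basis. f b (?T y \<bullet> b)) = (\<lambda>y. \<Prod>b\<in>Basis. f b (y b))"
    by (auto simp: coord fun_eq_iff intro!: prod.cong)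
  show "integrable lborel (\<lambda>x::'a. \<Prod>b\<in>Basis. f b (x \<bullet> b))"
    unfolding lborel_eq[where 'a='a] integrable_distr_eq[OF T m] comp
    by (rule P.product_integrable_prod) (use int in auto)
  show "(LINT x|lborel. (\<Prod>b\<in>Basis. f b (x \<bullet> b))) = (\<Prod>b\<in>Basis. (LINT t|lborel. f b t))"
    unfolding lborel_eq[where 'a='a] integral_distr[OF T m] comp
    by (rule P.product_integral_prod) (use int in auto)
qed

lemma integrable_gaussian_complex_width:
  assumes "0 < Re \<mu>"
  shows "integrable lborel (\<lambda>x::real. exp (\<i> * of_real (s * x) - \<mu> * of_real (x\<^sup>2)))"
proof (rule Bochner_Integration.integrable_bound[OF integrable_gaussian_real[OF assms]])
qed auto

lemma gaussian_factorisation: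
  fixes v \<xi> :: "'a::euclidean_space"
  shows "exp (\<i> * of_real (v \<bullet> \<xi>) - \<mu> * of_real ((norm \<xi>)\<^sup>2)) =
    (\<Prod>b\<in>Basis. exp (\<i> * of_real (v \<bullet> b * (\<xi> \<bullet> b)) - \<mu> * of_real ((\<xi> \<bullet> b)\<^sup>2)))"
proof -
  have "v \<bullet> \<xi> = (\<Sum>b\<in>Basis. v \<bullet> b * (\<xi> \<bullet> b))" by (rule euclidean_inner)
  moreover have "(norm \<xi>)\<^sup>2 = (\<Sum>b\<in>Basis. (\<xi> \<bullet> b)\<^sup>2)"
    unfolding power2_norm_eq_inner by (subst euclidean_inner) (simp add: power2_eq_square)
  ultimately show ?thesis
    by (simp add: exp_sum[symmetric] sum_subtractf sum_distrib_left)
qed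

lemma fourier_gaussian_euclidean:
  fixes v :: "'a::euclidean_space"
  assumes "0 < Re \<mu>"
  shows integrable_gaussian_euclidean: "integrable lborel (\<lambda>\<xi>::'a. exp (\<i> * of_real (v \<bullet> \<xi>) - \<mu> * of_real ((norm \<xi>)\<^sup>2)))" (is ?int)
    and "(LINT \<xi>|lborel. exp (\<i> * of_real (v \<bullet> \<xi>) - \<mu> * of_real ((norm \<xi>)\<^sup>2))) =
       csqrt (of_real pi / \<mu>) ^ DIM('a) * exp (- of_real ((norm v)\<^sup>2) / (4 * \<mu>))" (is ?val)
proof -
  show ?int unfolding gaussian_factorisation
    by (rule integrable_lborel_product) (rule integrable_gaussian_complex_width[OF assms])
  have "(norm v)\<^sup>2 = (\<Sum>b\<in>Basis. (v \<bullet> b)\<^sup>2)"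
    unfolding power2_norm_eq_inner by (subst euclidean_inner) (simp add: power2_eq_square)
  then have *: "exp (- of_real ((norm v)\<^sup>2) / (4 * \<mu>)) = (\<Prod>b\<in>Basis. exp (- of_real ((v \<bullet> b)\<^sup>2) / (4 * \<mu>)))"
    by (simp add: exp_sum[symmetric] sum_negf sum_divide_distrib)
  have "(LINT \<xi>|lborel. exp (\<i> * of_real (v \<bullet> \<xi>) - \<mu> * of_real ((norm \<xi>)\<^sup>2))) =
      (\<Prod>b\<in>(Basis::'a set). csqrt (of_real pi / \<mu>) * exp (- of_real ((v \<bullet> b)\<^sup>2) / (4 * \<mu>)))"
    unfolding gaussian_factorisation
    by (subst integral_lborel_product[OF integrable_gaussian_complex_width[OF assms]])
       (intro prod.cong refl fourier_gaussian_complex_width[OF assms])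
  then show ?val unfolding * by (simp only: prod.distrib prod_constant)
qed

section \<open>The free propagator as a rescaled Fourier transform\<close>

text \<open>
  The oscillating factor \<open>cis (- t * (norm \<xi>)\<^sup>2)\<close> is the limit, for \<open>k\<close> to infinity, of the
  Gaussians of width parameter \<open>1 / Suc k + \<i> * t\<close>. For these Fubini applies and the inner
  integral is explicit. Dominated convergence, with the Fourier transform as dominating function on one side and
  \<open>u0\<close> on the other, gives the limit of both sides.
\<close>

lemma schrodinger_evolution_kernel:
  fixes u0 :: "real ^ 'n \<Rightarrow> complex"
  assumes u0: "integrable lborel u0" and F: "integrable lborel (fourier u0)" and t: "0 < t"
  shows "schrodinger_evolution u0 x t = of_real ((2 * pi) powr (- real CARD('n))) *
     csqrt (of_real pi / (\<i> * of_real t)) ^ CARD('n) *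
     (LINT y|lborel. exp (- of_real ((norm (x - y))\<^sup>2) / (4 * (\<i> * of_real t))) * u0 y)"
proof -
  define c where "c = complex_of_real ((2 * pi) powr (- real CARD('n) / 2))"
  define \<mu> where "\<mu> = (\<lambda>k. of_real (1 / real (Suc k)) + \<i> * complex_of_real t)"
  define J where "J = (\<lambda>k. LINT \<xi>|lborel. exp (\<i> * of_real (x \<bullet> \<xi>) - \<mu> k * of_real ((norm \<xi>)\<^sup>2)) * fourier u0 \<xi>)"
  define K where "K = (\<lambda>\<mu> y. exp (- of_real ((norm (x - y))\<^sup>2) / (4 * \<mu>)) * u0 y)"
  have [measurable]: "u0 \<in> borel_measurable borel" "fourier u0 \<in> borel_measurable borel"
    using borel_measurable_integrable[OF u0] borel_measurable_integrable[OF F] by auto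
  have Re_mu: "0 < Re (\<mu> k)" for k by (simp add: \<mu>_def)
  have mu_lim: "\<mu> \<longlonglongrightarrow> \<i> * of_real t"
  proof -
    have "(\<lambda>k. of_real (1 / real (Suc k)) + \<i> * complex_of_real t) \<longlonglongrightarrow> of_real 0 + \<i> * of_real t"
      by (intro tendsto_intros) (use LIMSEQ_inverse_real_of_nat in \<open>simp add: inverse_eq_divide\<close>)
    then show ?thesis by (simp add: \<mu>_def)
  qed
  have it: "\<i> * complex_of_real t \<noteq> 0" using t by simp
  have J_lim: "J \<longlonglongrightarrow> (LINT \<xi>|lborel. cis (x \<bullet> \<xi>) * (cis (- t * (norm \<xi>)\<^sup>2) * fourier u0 \<xi>))"
    unfolding J_def
  proof (rule integral_dominated_convergence)
    show "integrable lborel (\<lambda>\<xi>. norm (fourier u0 \<xi>))" using F by simp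
    show "AE \<xi> in lborel. (\<lambda>k. exp (\<i> * of_real (x \<bullet> \<xi>) - \<mu> k * of_real ((norm \<xi>)\<^sup>2)) * fourier u0 \<xi>)
       \<longlonglongrightarrow> cis (x \<bullet> \<xi>) * (cis (- t * (norm \<xi>)\<^sup>2) * fourier u0 \<xi>)"
    proof (rule AE_I2)
      fix \<xi> :: "real ^ 'n"
      have "(\<lambda>k. exp (\<i> * of_real (x \<bullet> \<xi>) - \<mu> k * of_real ((norm \<xi>)\<^sup>2)) * fourier u0 \<xi>)
         \<longlonglongrightarrow> exp (\<i> * of_real (x \<bullet> \<xi>) - (\<i> * of_real t) * of_real ((norm \<xi>)\<^sup>2)) * fourier u0 \<xi>"
        by (intro tendsto_intros mu_lim)
      also have "exp (\<i> * of_real (x \<bullet> \<xi>) - (\<i> * of_real t) * of_real ((norm \<xi>)\<^sup>2)) =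
          cis (x \<bullet> \<xi>) * cis (- t * (norm \<xi>)\<^sup>2)"
        by (simp add: cis_conv_exp mult.assoc flip: exp_add)
      finally show "(\<lambda>k. exp (\<i> * of_real (x \<bullet> \<xi>) - \<mu> k * of_real ((norm \<xi>)\<^sup>2)) * fourier u0 \<xi>)
       \<longlonglongrightarrow> cis (x \<bullet> \<xi>) * (cis (- t * (norm \<xi>)\<^sup>2) * fourier u0 \<xi>)" by (simp only: mult.assoc)
    qed
    show "AE \<xi> in lborel. norm (exp (\<i> * of_real (x \<bullet> \<xi>) - \<mu> k * of_real ((norm \<xi>)\<^sup>2)) * fourier u0 \<xi>) \<le> norm (fourier u0 \<xi>)" for k
    proof (rule AE_I2)
      fix \<xi> :: "real ^ 'n"
      have "Re (\<i> * of_real (x \<bullet> \<xi>) - \<mu> k * of_real ((norm \<xi>)\<^sup>2)) = - (Re (\<mu> k) * (norm \<xi>)\<^sup>2)"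
        by (simp del: of_real_power)
      also have "\<dots> \<le> 0" using Re_mu[of k] by simp
      finally show "norm (exp (\<i> * of_real (x \<bullet> \<xi>) - \<mu> k * of_real ((norm \<xi>)\<^sup>2)) * fourier u0 \<xi>) \<le> norm (fourier u0 \<xi>)"
        unfolding norm_mult norm_exp_eq_Re by (intro mult_left_le_one_le) auto
    qed
  qed (unfold cis_conv_exp, measurable)
  have J_val: "J k = c * (csqrt (of_real pi / \<mu> k) ^ CARD('n) * (LINT y|lborel. K (\<mu> k) y))" for k
  proof -
    define f where "f = (\<lambda>\<xi> y. exp (\<i> * of_real ((x - y) \<bullet> \<xi>) - \<mu> k * of_real ((norm \<xi>)\<^sup>2)) * u0 y)"
    have nf: "norm (f \<xi> y) = exp (- Re (\<mu> k) * (norm \<xi>)\<^sup>2) * norm (u0 y)" for \<xi> y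
      by (simp add: f_def norm_mult)
    have gi: "integrable lborel (\<lambda>\<xi>::real^'n. exp (- Re (\<mu> k) * (norm \<xi>)\<^sup>2))"
      using integrable_norm[OF integrable_gaussian_euclidean[OF Re_mu[of k], of "0::real^'n"]] by simp
    have "integrable (lborel \<Otimes>\<^sub>M lborel) (case_prod f)"
    proof (rule lborel_pair.Fubini_integrable)
      show "case_prod f \<in> borel_measurable (lborel \<Otimes>\<^sub>M lborel)" unfolding f_def by measurable
      show "integrable lborel (\<lambda>\<xi>. LINT y|lborel. norm (case_prod f (\<xi>, y)))"
        unfolding prod.case nf using gi by simp
      show "AE \<xi> in lborel. integrable lborel (\<lambda>y. case_prod f (\<xi>, y))"
      proof (rule AE_I2)
        fix \<xi> :: "real^'n"
        have "integrable lborel (\<lambda>y. exp (- Re (\<mu> k) * (norm \<xi>)\<^sup>2) * norm (u0 y))" using u0 by simp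
        then show "integrable lborel (\<lambda>y. case_prod f (\<xi>, y))"
          unfolding prod.case
        proof (rule Bochner_Integration.integrable_bound)
          show "f \<xi> \<in> borel_measurable lborel" unfolding f_def by measurable
          show "AE y in lborel. norm (f \<xi> y) \<le> norm (exp (- Re (\<mu> k) * (norm \<xi>)\<^sup>2) * norm (u0 y))"
            unfolding nf by simp
        qed
      qed
    qed
    then have swap: "(LINT \<xi>|lborel. LINT y|lborel. f \<xi> y) = (LINT y|lborel. LINT \<xi>|lborel. f \<xi> y)"
      by (rule lborel_pair.Fubini_integral[symmetric])
    have "J k = (LINT \<xi>|lborel. c * (LINT y|lborel. f \<xi> y))"
      unfolding J_def
    proof (rule Bochner_Integration.integral_cong[OF refl])
      fix \<xi> :: "real^'n"
      have "exp (\<i> * of_real (x \<bullet> \<xi>) - \<mu> k * of_real ((norm \<xi>)\<^sup>2)) * (LINT y|lborel. cis (- (y \<bullet> \<xi>)) * u0 y)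
          = (LINT y|lborel. exp (\<i> * of_real (x \<bullet> \<xi>) - \<mu> k * of_real ((norm \<xi>)\<^sup>2)) * (cis (- (y \<bullet> \<xi>)) * u0 y))"
        by simp
      also have "\<dots> = (LINT y|lborel. f \<xi> y)"
      proof (rule Bochner_Integration.integral_cong[OF refl])
        fix y
        have "exp (\<i> * of_real (x \<bullet> \<xi>) - \<mu> k * of_real ((norm \<xi>)\<^sup>2)) * cis (- (y \<bullet> \<xi>)) =
            exp (\<i> * of_real ((x - y) \<bullet> \<xi>) - \<mu> k * of_real ((norm \<xi>)\<^sup>2))"
          by (simp add: cis_conv_exp inner_diff_left algebra_simps flip: exp_add)
        then show "exp (\<i> * of_real (x \<bullet> \<xi>) - \<mu> k * of_real ((norm \<xi>)\<^sup>2)) * (cis (- (y \<bullet> \<xi>)) * u0 y) = f \<xi> y"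
          by (simp only: f_def mult.assoc[symmetric])
      qed
      finally show "exp (\<i> * of_real (x \<bullet> \<xi>) - \<mu> k * of_real ((norm \<xi>)\<^sup>2)) * fourier u0 \<xi> = c * (LINT y|lborel. f \<xi> y)"
        by (simp add: fourier_def c_def mult.left_commute)
    qed
    also have "\<dots> = c * (LINT y|lborel. LINT \<xi>|lborel. f \<xi> y)" by (simp add: swap)
    also have "(LINT y|lborel. LINT \<xi>|lborel. f \<xi> y) =
        (LINT y|lborel. csqrt (of_real pi / \<mu> k) ^ CARD('n) * K (\<mu> k) y)"
    proof (rule Bochner_Integration.integral_cong[OF refl])
      fix y
      show "(LINT \<xi>|lborel. f \<xi> y) = csqrt (of_real pi / \<mu> k) ^ CARD('n) * K (\<mu> k) y"
        unfolding f_def K_def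
        using fourier_gaussian_euclidean(2)[OF Re_mu[of k], of "x - y"] by simp
    qed
    finally show ?thesis by simp
  qed
  have K_lim: "(\<lambda>k. LINT y|lborel. K (\<mu> k) y) \<longlonglongrightarrow> (LINT y|lborel. K (\<i> * of_real t) y)"
  proof (rule integral_dominated_convergence)
    show "integrable lborel (\<lambda>y. norm (u0 y))" using u0 by simp
    show "AE y in lborel. (\<lambda>k. K (\<mu> k) y) \<longlonglongrightarrow> K (\<i> * of_real t) y"
      unfolding K_def using it by (intro AE_I2 tendsto_intros mu_lim) auto
    show "AE y in lborel. norm (K (\<mu> k) y) \<le> norm (u0 y)" for k
    proof (rule AE_I2)
      fix y
      have "0 \<le> Re (of_real ((norm (x - y))\<^sup>2) / (4 * \<mu> k))"
        using Re_mu[of k] by (simp add: Re_divide)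
      then show "norm (K (\<mu> k) y) \<le> norm (u0 y)"
        unfolding K_def norm_mult norm_exp_eq_Re by (intro mult_left_le_one_le) auto
    qed
  qed (unfold K_def, measurable)
  have "of_real pi / (\<i> * complex_of_real t) \<notin> \<real>\<^sub>\<le>\<^sub>0"
    using t by (auto simp: complex_nonpos_Reals_iff Im_divide)
  then have "(\<lambda>k. csqrt (of_real pi / \<mu> k)) \<longlonglongrightarrow> csqrt (of_real pi / (\<i> * of_real t))"
    using it by (intro isCont_tendsto_compose[OF continuous_at_csqrt] tendsto_intros mu_lim) auto
  then have "J \<longlonglongrightarrow> c * (csqrt (of_real pi / (\<i> * of_real t)) ^ CARD('n) * (LINT y|lborel. K (\<i> * of_real t) y))"
    unfolding J_val by (intro tendsto_intros K_lim)
  from LIMSEQ_unique[OF J_lim this]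
  have "schrodinger_evolution u0 x t = (c * c) * csqrt (of_real pi / (\<i> * of_real t)) ^ CARD('n) * (LINT y|lborel. K (\<i> * of_real t) y)"
    by (simp add: schrodinger_evolution_def inverse_fourier_def c_def)
  moreover have "c * c = of_real ((2 * pi) powr (- real CARD('n)))"
    by (simp add: c_def flip: of_real_mult powr_add)
  ultimately show ?thesis by (simp add: K_def)
qed

definition scaled_fourier :: "real \<Rightarrow> ('a::euclidean_space \<Rightarrow> complex) \<Rightarrow> 'a \<Rightarrow> complex" where
  "scaled_fourier T f x = (LINT y|lborel. exp (- \<i> * of_real (x \<bullet> y) / of_real (2 * T)) * f y)"

lemma borel_measurable_scaled_fourier [measurable]:
  fixes f :: "'a::euclidean_space \<Rightarrow> complex"
  assumes [measurable]: "f \<in> borel_measurable borel"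
  shows "scaled_fourier T f \<in> borel_measurable borel"
  unfolding scaled_fourier_def[abs_def] by measurable

text \<open>
  The phase \<open>\<i> * (norm (x - y))\<^sup>2 / (4 * t)\<close> of the kernel splits into a term in \<open>x\<close> alone, which
  does not affect the modulus, the bilinear term, and a term in \<open>y\<close> alone, which is attached to
  the datum.
\<close>

lemma schrodinger_evolution_scaled_fourier:
  fixes u0 :: "real ^ 'n \<Rightarrow> complex"
  assumes u0: "integrable lborel u0" and F: "integrable lborel (fourier u0)" and t: "0 < t"
  shows "(norm (schrodinger_evolution u0 x t))\<^sup>2 =
     (norm (scaled_fourier t (\<lambda>y. cis ((norm y)\<^sup>2 / (4 * t)) * u0 y) x))\<^sup>2 / (4 * pi * t) ^ CARD('n)"
proof -
  let ?f = "\<lambda>y. cis ((norm y)\<^sup>2 / (4 * t)) * u0 y"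
  have phase: "exp (- of_real ((norm (x - y))\<^sup>2) / (4 * (\<i> * of_real t))) * u0 y =
      cis ((norm x)\<^sup>2 / (4 * t)) * (exp (- \<i> * of_real (x \<bullet> y) / of_real (2 * t)) * ?f y)" for y
  proof -
    have "(norm (x - y))\<^sup>2 = (norm x)\<^sup>2 - 2 * (x \<bullet> y) + (norm y)\<^sup>2"
      by (simp add: power2_norm_eq_inner inner_diff_left inner_diff_right inner_commute)
    then have "(norm (x - y))\<^sup>2 / (4 * t) = (norm x)\<^sup>2 / (4 * t) - x \<bullet> y / (2 * t) + (norm y)\<^sup>2 / (4 * t)"
      using t by (simp add: field_simps)
    moreover have "- complex_of_real ((norm (x - y))\<^sup>2) / (4 * (\<i> * of_real t)) = \<i> * of_real ((norm (x - y))\<^sup>2 / (4 * t))"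
      using t by (simp add: field_simps)
    moreover have "- \<i> * complex_of_real (x \<bullet> y) / of_real (2 * t) = \<i> * of_real (- (x \<bullet> y / (2 * t)))"
      by simp
    ultimately have "exp (- complex_of_real ((norm (x - y))\<^sup>2) / (4 * (\<i> * of_real t))) =
       cis ((norm x)\<^sup>2 / (4 * t) + - (x \<bullet> y / (2 * t)) + (norm y)\<^sup>2 / (4 * t))"
      "exp (- \<i> * complex_of_real (x \<bullet> y) / of_real (2 * t)) = cis (- (x \<bullet> y / (2 * t)))"
      by (simp_all only: cis_conv_exp diff_conv_add_uminus)
    then show ?thesis by (simp only: cis_mult[symmetric] mult.assoc)
  qed
  have "norm (csqrt (of_real pi / (\<i> * of_real t))) = sqrt (pi / t)"
    using t by (simp add: norm_divide norm_mult)
  then have "norm (schrodinger_evolution u0 x t) =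
     (2 * pi) powr (- real CARD('n)) * sqrt (pi / t) ^ CARD('n) * norm (scaled_fourier t ?f x)"
    unfolding schrodinger_evolution_kernel[OF u0 F t] phase scaled_fourier_def
    by (simp add: norm_mult norm_power)
  also have "(2 * pi) powr (- real CARD('n)) = (1 / (2 * pi)) ^ CARD('n)"
    by (subst powr_minus, subst powr_realpow) (auto simp: inverse_eq_divide power_one_over)
  finally have "norm (schrodinger_evolution u0 x t) = (1 / (2 * pi) * sqrt (pi / t)) ^ CARD('n) * norm (scaled_fourier t ?f x)"
    by (simp only: power_mult_distrib)
  then have "(norm (schrodinger_evolution u0 x t))\<^sup>2 = ((1 / (2 * pi) * sqrt (pi / t))\<^sup>2) ^ CARD('n) * (norm (scaled_fourier t ?f x))\<^sup>2"
    by (simp add: power_mult_distrib flip: power_mult) (simp add: mult.commute)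
  also have "(1 / (2 * pi) * sqrt (pi / t))\<^sup>2 = 1 / (4 * pi * t)"
    using t by (simp add: power_mult_distrib power_divide field_simps power2_eq_square)
  finally show ?thesis by (simp add: power_divide)
qed

lemma borel_measurable_fourier:
  assumes [measurable]: "f \<in> borel_measurable borel"
  shows "fourier f \<in> borel_measurable borel"
  unfolding fourier_def[abs_def] cis_conv_exp by measurable

text \<open>
  A nonintegrable function has integral zero by convention, and the unimodular factors in the
  multiplier do not change integrability.
\<close>

lemma schrodinger_evolution_not_integrable:
  fixes u0 :: "real ^ 'n \<Rightarrow> complex"
  assumes u0: "u0 \<in> borel_measurable borel" and F: "\<not> integrable lborel (fourier u0)"
  shows "schrodinger_evolution u0 x t = 0"
proof -
  let ?I = "\<lambda>\<xi>. cis (x \<bullet> \<xi>) * (cis (- t * (norm \<xi>)\<^sup>2) * fourier u0 \<xi>)"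
  have "\<not> integrable lborel ?I"
  proof
    assume I: "integrable lborel ?I"
    have "integrable lborel (fourier u0)"
      by (rule Bochner_Integration.integrable_bound[OF I])
         (use borel_measurable_fourier[OF u0] in \<open>auto simp: norm_mult\<close>)
    with F show False ..
  qed
  then show ?thesis
    by (simp add: schrodinger_evolution_def inverse_fourier_def not_integrable_integral_eq)
qed

lemma smooth_compact_supportD:
  fixes u0 :: "real ^ 'n \<Rightarrow> complex"
  assumes "smooth_compact_support u0"
  shows "u0 \<in> borel_measurable borel" "integrable lborel u0"
    "integrable lborel (\<lambda>x. exp (a * norm x) * (norm (u0 x))\<^sup>2)"
proof -
  define S where "S = closure {x. u0 x \<noteq> 0}"
  have "continuously_differentiable 0 u0" and S: "compact S"
    using assms unfolding smooth_compact_support_def S_def by blast+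
  then have c: "continuous_on UNIV u0" by simp
  have out: "u0 x = 0" if "x \<notin> S" for x 
    using that subsetD[OF closure_subset, of x "{x. u0 x \<noteq> 0}"] unfolding S_def by auto
  show "u0 \<in> borel_measurable borel" using c by (rule borel_measurable_continuous_onI)
  have "integrable lborel (\<lambda>x. indicator S x *\<^sub>R u0 x)"
    by (rule borel_integrable_compact[OF S continuous_on_subset[OF c]]) simp
  also have "(\<lambda>x. indicator S x *\<^sub>R u0 x) = u0" using out by (auto simp: fun_eq_iff indicator_def)
  finally show "integrable lborel u0" .
  let ?w = "\<lambda>x. exp (a * norm x) * (norm (u0 x))\<^sup>2"
  have "continuous_on S ?w"
    by (intro continuous_intros continuous_on_subset[OF c]) auto
  then have "integrable lborel (\<lambda>x. indicator S x *\<^sub>R ?w x)" by (rule borel_integrable_compact[OF S])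
  also have "(\<lambda>x. indicator S x *\<^sub>R ?w x) = ?w" using out by (auto simp: fun_eq_iff indicator_def)
  finally show "integrable lborel ?w" .
qed

text \<open>
  The statement covers both cases of the preceding lemmas: \<open>f\<close> is the datum with its quadratic phase if the
  Fourier transform is integrable, and zero if the evolution vanishes by convention.
\<close>

lemma schrodinger_evolution_as_scaled_fourier:
  fixes u0 :: "real ^ 'n \<Rightarrow> complex"
  assumes u0: "integrable lborel u0" and t: "0 < t"
  obtains f where "f \<in> borel_measurable borel" "\<And>y. norm (f y) \<le> norm (u0 y)"
    "\<And>x. (norm (schrodinger_evolution u0 x t))\<^sup>2 = (norm (scaled_fourier t f x))\<^sup>2 / (4 * pi * t) ^ CARD('n)"
proof (cases "integrable lborel (fourier u0)")
  case True
  have [measurable]: "u0 \<in> borel_measurable borel" using borel_measurable_integrable[OF u0] by simp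
  show ?thesis
  proof (rule that[of "\<lambda>y. cis ((norm y)\<^sup>2 / (4 * t)) * u0 y"])
    show "(\<lambda>y. cis ((norm y)\<^sup>2 / (4 * t)) * u0 y) \<in> borel_measurable borel"
      unfolding cis_conv_exp by measurable
  qed (auto simp: norm_mult schrodinger_evolution_scaled_fourier[OF u0 True t])
next
  case False
  have u0m: "u0 \<in> borel_measurable borel" using borel_measurable_integrable[OF u0] by simp
  show ?thesis
    by (rule that[of "\<lambda>_. 0"])
       (auto simp: scaled_fourier_def schrodinger_evolution_not_integrable[OF u0m False])
qed

section \<open>Integration lemmas\<close>

lemma integral_Cauchy_Schwarz:
  fixes f g :: "'a \<Rightarrow> real"
  assumes f: "integrable M (\<lambda>x. (f x)\<^sup>2)" and g: "integrable M (\<lambda>x. (g x)\<^sup>2)"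
    and fg: "integrable M (\<lambda>x. f x * g x)"
  shows "(\<integral>x. f x * g x \<partial>M)\<^sup>2 \<le> (\<integral>x. (f x)\<^sup>2 \<partial>M) * (\<integral>x. (g x)\<^sup>2 \<partial>M)"
proof -
  define P where "P = (\<integral>x. (f x)\<^sup>2 \<partial>M)"
  define Q where "Q = (\<integral>x. (g x)\<^sup>2 \<partial>M)"
  define X where "X = (\<integral>x. f x * g x \<partial>M)"
  have key: "0 \<le> P - 2 * s * X + s\<^sup>2 * Q" for s
  proof -
    have "0 \<le> (\<integral>x. (f x - s * g x)\<^sup>2 \<partial>M)" by simp
    also have "(\<lambda>x. (f x - s * g x)\<^sup>2) = (\<lambda>x. (f x)\<^sup>2 - 2 * s * (f x * g x) + s\<^sup>2 * (g x)\<^sup>2)"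
      by (simp add: fun_eq_iff power2_eq_square algebra_simps)
    finally show ?thesis using f g fg by (simp add: P_def Q_def X_def)
  qed
  have "0 \<le> Q" by (simp add: Q_def)
  show ?thesis
  proof (cases "Q = 0")
    case True
    have "X = 0"
    proof (rule ccontr)
      assume "X \<noteq> 0"
      with key[of "(P + 1) / (2 * X)"] True show False by simp
    qed
    then show ?thesis by (simp add: P_def[symmetric] Q_def[symmetric] X_def[symmetric] True)
  next
    case False
    with \<open>0 \<le> Q\<close> have "0 < Q" by simp
    with key[of "X / Q"] have "X\<^sup>2 \<le> P * Q" by (simp add: power2_eq_square field_simps)
    then show ?thesis by (simp add: P_def Q_def X_def)
  qed
qed

lemma integral_lborel_affine:
  fixes f :: "'a::euclidean_space \<Rightarrow> 'b::{banach,second_countable_topology}"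
  assumes [measurable]: "f \<in> borel_measurable borel" and c: "c \<noteq> 0"
  shows integrable_lborel_affine_iff: "integrable lborel (\<lambda>x. f (t + c *\<^sub>R x)) \<longleftrightarrow> integrable lborel f"
    and "(LINT x|lborel. f x) = \<bar>c\<bar> ^ DIM('a) *\<^sub>R (LINT x|lborel. f (t + c *\<^sub>R x))"
proof -
  have "integrable lborel f \<longleftrightarrow> integrable (density (distr lborel borel (\<lambda>x. t + c *\<^sub>R x)) (\<lambda>_. \<bar>c\<bar> ^ DIM('a))) f"
    by (subst lborel_affine[OF c, of t]) simp
  also have "\<dots> \<longleftrightarrow> integrable lborel (\<lambda>x. \<bar>c\<bar> ^ DIM('a) *\<^sub>R f (t + c *\<^sub>R x))"
    by (simp add: integrable_density integrable_distr_eq)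
  also have "\<dots> \<longleftrightarrow> integrable lborel (\<lambda>x. f (t + c *\<^sub>R x))"
  proof
    assume "integrable lborel (\<lambda>x. \<bar>c\<bar> ^ DIM('a) *\<^sub>R f (t + c *\<^sub>R x))"
    then have "integrable lborel (\<lambda>x. inverse (\<bar>c\<bar> ^ DIM('a)) *\<^sub>R \<bar>c\<bar> ^ DIM('a) *\<^sub>R f (t + c *\<^sub>R x))"
      by (rule integrable_scaleR_right)
    then show "integrable lborel (\<lambda>x. f (t + c *\<^sub>R x))" using c by simp
  qed simp
  finally show "integrable lborel (\<lambda>x. f (t + c *\<^sub>R x)) \<longleftrightarrow> integrable lborel f" ..
  have "(LINT x|lborel. f x) = (LINT x|density (distr lborel borel (\<lambda>x. t + c *\<^sub>R x)) (\<lambda>_. \<bar>c\<bar> ^ DIM('a)). f x)"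
    by (subst lborel_affine[OF c, of t]) simp
  also have "\<dots> = \<bar>c\<bar> ^ DIM('a) *\<^sub>R (LINT x|lborel. f (t + c *\<^sub>R x))"
    by (simp add: integral_density integral_distr)
  finally show "(LINT x|lborel. f x) = \<bar>c\<bar> ^ DIM('a) *\<^sub>R (LINT x|lborel. f (t + c *\<^sub>R x))" .
qed

lemma integrable_exp_neg_abs:
  fixes k :: real assumes "0 < k"
  shows "integrable lborel (\<lambda>x::real. exp (- k * \<bar>x\<bar>))"
proof -
  define f where "f = (\<lambda>x::real. indicator {0<..} x *\<^sub>R exp (- (x * k)))"
  have f: "integrable lborel f"
    using integrable_I0i_exp_mscale[OF assms] by (simp add: f_def set_integrable_def)
  have "integrable lborel (\<lambda>x. f x + f (0 + (-1) * x))"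
    using f by (intro Bochner_Integration.integrable_add lborel_integrable_real_affine) auto
  then show ?thesis
  proof (rule Bochner_Integration.integrable_bound)
    show "AE x in lborel. norm (exp (- k * \<bar>x\<bar>)) \<le> norm (f x + f (0 + (-1) * x))"
      using AE_lborel_singleton[of "0::real"]
      by eventually_elim (auto simp: f_def indicator_def mult.commute)
  qed measurable
qed

lemma integrable_exp_neg_norm:
  fixes k :: real assumes k: "0 < k"
  shows "integrable lborel (\<lambda>x::'a::euclidean_space. exp (- k * norm x))"
proof -
  let ?n = "real DIM('a)"
  have "integrable lborel (\<lambda>x::'a. \<Prod>b\<in>Basis. exp (- (k / ?n) * \<bar>x \<bullet> b\<bar>))"
    using k by (intro integrable_lborel_product integrable_exp_neg_abs) auto
  then show ?thesis
  proof (rule Bochner_Integration.integrable_bound)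
    show "AE x::'a in lborel. norm (exp (- k * norm x)) \<le> norm (\<Prod>b\<in>Basis. exp (- (k / ?n) * \<bar>x \<bullet> b\<bar>))"
    proof (rule AE_I2)
      fix x :: 'a
      have "(\<Sum>b\<in>Basis. \<bar>x \<bullet> b\<bar>) \<le> (\<Sum>b\<in>(Basis::'a set). norm x)"
        by (intro sum_mono Basis_le_norm)
      then have "k / ?n * (\<Sum>b\<in>Basis. \<bar>x \<bullet> b\<bar>) \<le> k / ?n * (?n * norm x)"
        using k by (intro mult_left_mono) auto
      then have "- k * norm x \<le> - (k / ?n) * (\<Sum>b\<in>Basis. \<bar>x \<bullet> b\<bar>)" by simp
      also have "\<dots> = (\<Sum>b\<in>Basis. - (k / ?n) * \<bar>x \<bullet> b\<bar>)" by (rule sum_distrib_left)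
      finally have "- k * norm x \<le> (\<Sum>b\<in>Basis. - (k / ?n) * \<bar>x \<bullet> b\<bar>)" .
      then show "norm (exp (- k * norm x)) \<le> norm (\<Prod>b\<in>Basis. exp (- (k / ?n) * \<bar>x \<bullet> b\<bar>))"
        by (simp flip: exp_sum)
    qed
  qed measurable
qed

lemma integral_exp_neg_norm:
  fixes z :: "'a::euclidean_space" and k :: real
  assumes k: "0 < k"
  shows integrable_exp_neg_dist: "integrable lborel (\<lambda>x. exp (- k * norm (x - z)))"
    and "(LINT x|lborel. exp (- k * norm (x - z))) = (LINT x::'a|lborel. exp (- norm x)) / k ^ DIM('a)"
proof -
  let ?f = "\<lambda>x::'a. exp (- norm x)"
  have [measurable]: "?f \<in> borel_measurable borel" by measurable
  have f: "integrable lborel ?f" using integrable_exp_neg_norm[of 1] by simp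
  have eq: "exp (- k * norm (x - z)) = ?f (- (k *\<^sub>R z) + k *\<^sub>R x)" for x
  proof -
    have "norm (- (k *\<^sub>R z) + k *\<^sub>R x) = norm (k *\<^sub>R (x - z))" by (simp add: scaleR_diff_right)
    also have "\<dots> = k * norm (x - z)" using k by simp
    finally show ?thesis by simp
  qed
  show "integrable lborel (\<lambda>x. exp (- k * norm (x - z)))"
    unfolding eq using integrable_lborel_affine_iff[of ?f k "- (k *\<^sub>R z)"] f k by simp
  show "(LINT x|lborel. exp (- k * norm (x - z))) = (LINT x::'a|lborel. exp (- norm x)) / k ^ DIM('a)"
    unfolding eq using integral_lborel_affine(2)[of ?f k "- (k *\<^sub>R z)"] k by simp
qed
text \<open>
  Split at distance \<open>L\<close> from \<open>z\<close>. In the far region half of the exponential weight gives the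
  small factor, and the other half keeps the integral finite.
\<close>

lemma exponentially_weighted_integral_le:
  fixes G :: "'a::euclidean_space \<Rightarrow> real"
  assumes [measurable]: "G \<in> borel_measurable borel" and b: "0 < b"
    and G: "\<And>x. 0 \<le> G x" "\<And>x. G x \<le> B" and Q: "0 \<le> Q" "\<And>x. norm (x - z) \<le> L \<Longrightarrow> G x \<le> Q"
  shows "(LINT x|lborel. exp (- b * norm (x - z)) * G x) \<le>
    (LINT x::'a|lborel. exp (- norm x)) / b ^ DIM('a) * (Q + 2 ^ DIM('a) * exp (- b * L / 2) * B)"
proof -
  define e where "e = (\<lambda>k (x::'a). exp (- k * norm (x - z)))"
  have ie: "integrable lborel (e b)" "integrable lborel (e (b / 2))"
    unfolding e_def using b by (intro integrable_exp_neg_dist; simp)+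
  have [measurable]: "e k \<in> borel_measurable borel" for k unfolding e_def by measurable
  have B: "0 \<le> B" using order_trans[OF G(1) G(2)] .
  have iG: "integrable lborel (\<lambda>x. e b x * G x)"
  proof (rule Bochner_Integration.integrable_bound)
    show "integrable lborel (\<lambda>x. e b x * B)" using ie by simp
    show "AE x in lborel. norm (e b x * G x) \<le> norm (e b x * B)"
      using G B by (intro AE_I2) (auto simp: e_def abs_mult intro!: mult_left_mono)
  qed measurable
  have le: "e b x * G x \<le> Q * e b x + exp (- b * L / 2) * B * e (b / 2) x" for x
  proof (cases "norm (x - z) \<le> L")
    case True
    have "e b x * G x \<le> e b x * Q" using Q(2)[OF True] by (intro mult_left_mono) (auto simp: e_def)
    moreover have "0 \<le> exp (- b * L / 2) * B * e (b / 2) x" using B by (simp add: e_def)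
    ultimately show ?thesis by (simp add: mult.commute)
  next
    case False
    have "e b x = exp (- b * norm (x - z) / 2) * e (b / 2) x"
      by (simp add: e_def flip: exp_add)
    also have "\<dots> \<le> exp (- b * L / 2) * e (b / 2) x"
      using False b by (intro mult_right_mono) (auto simp: e_def)
    finally have "e b x * G x \<le> (exp (- b * L / 2) * e (b / 2) x) * B"
      using G B by (intro mult_mono) (auto simp: e_def)
    moreover have "0 \<le> Q * e b x" using Q by (simp add: e_def)
    ultimately show ?thesis by (simp add: mult_ac)
  qed
  have "(LINT x|lborel. e b x * G x) \<le> (LINT x|lborel. Q * e b x + exp (- b * L / 2) * B * e (b / 2) x)"
    by (rule integral_mono[OF iG _ le]) (use ie in simp)
  also have "\<dots> = Q * (LINT x|lborel. e b x) + exp (- b * L / 2) * B * (LINT x|lborel. e (b / 2) x)"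
    using ie by simp
  also have "(LINT x|lborel. e b x) = (LINT x::'a|lborel. exp (- norm x)) / b ^ DIM('a)"
    unfolding e_def by (rule integral_exp_neg_norm(2)[OF b])
  also have "(LINT x|lborel. e (b / 2) x) = (LINT x::'a|lborel. exp (- norm x)) / (b / 2) ^ DIM('a)"
    unfolding e_def using b by (intro integral_exp_neg_norm(2)) simp
  finally show ?thesis using b by (simp add: e_def power_divide field_simps)
qed

section \<open>Analytic continuation along lines\<close>

text \<open>
  Cauchy-Schwarz for the product of \<open>exp (a / 2 * norm y) * norm (f y)\<close> and
  \<open>exp (- (a / 4) * norm y)\<close>.
\<close>

lemma exponential_weight_L1_L2:
  fixes f :: "'a::euclidean_space \<Rightarrow> complex"
  assumes [measurable]: "f \<in> borel_measurable borel" and a: "0 < a"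
    and M: "integrable lborel (\<lambda>y. exp (a * norm y) * (norm (f y))\<^sup>2)"
  shows integrable_exponential_weight_L1: "integrable lborel (\<lambda>y. exp (a / 4 * norm y) * norm (f y))"
    and "(LINT y|lborel. exp (a / 4 * norm y) * norm (f y))\<^sup>2 \<le>
       (LINT y|lborel. exp (a * norm y) * (norm (f y))\<^sup>2) * ((LINT y::'a|lborel. exp (- norm y)) / (a / 2) ^ DIM('a))"
proof -
  define p where "p = (\<lambda>y. exp (a / 2 * norm y) * norm (f y))"
  define q where "q = (\<lambda>y::'a. exp (- (a / 4) * norm y))"
  have p2: "(\<lambda>y. (p y)\<^sup>2) = (\<lambda>y. exp (a * norm y) * (norm (f y))\<^sup>2)"
    by (simp add: p_def power_mult_distrib fun_eq_iff flip: exp_of_nat_mult)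
  have q2: "(\<lambda>y. (q y)\<^sup>2) = (\<lambda>y. exp (- (a / 2) * norm (y - 0)))"
    by (simp add: q_def fun_eq_iff flip: exp_of_nat_mult)
  have pq: "(\<lambda>y. p y * q y) = (\<lambda>y. exp (a / 4 * norm y) * norm (f y))"
  proof
    fix y :: 'a
    have "exp (a / 2 * norm y) * exp (- (a / 4) * norm y) = exp (a / 4 * norm y)"
      by (simp flip: exp_add)
    then show "p y * q y = exp (a / 4 * norm y) * norm (f y)"
      by (simp add: p_def q_def mult.commute mult.left_commute)
  qed
  have [measurable]: "p \<in> borel_measurable borel" "q \<in> borel_measurable borel"
    unfolding p_def q_def by measurable
  have ip: "integrable lborel (\<lambda>y. (p y)\<^sup>2)" unfolding p2 by (rule M)
  have iq: "integrable lborel (\<lambda>y. (q y)\<^sup>2)"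
    unfolding q2 using a by (intro integrable_exp_neg_dist) simp
  have ipq: "integrable lborel (\<lambda>y. p y * q y)"
  proof (rule Bochner_Integration.integrable_bound[OF Bochner_Integration.integrable_add[OF ip iq]])
    show "AE y in lborel. norm (p y * q y) \<le> norm ((p y)\<^sup>2 + (q y)\<^sup>2)"
    proof (rule AE_I2)
      fix y
      have n: "0 \<le> p y * q y" by (simp add: p_def q_def)
      then have "norm (p y * q y) = p y * q y" by simp
      also have "\<dots> \<le> (p y)\<^sup>2 + (q y)\<^sup>2"
        using sum_squares_bound[of "p y" "q y"] n unfolding mult.assoc by linarith
      also have "\<dots> \<le> norm ((p y)\<^sup>2 + (q y)\<^sup>2)" by simp
      finally show "norm (p y * q y) \<le> norm ((p y)\<^sup>2 + (q y)\<^sup>2)" .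
    qed
  qed measurable
  then show "integrable lborel (\<lambda>y. exp (a / 4 * norm y) * norm (f y))" unfolding pq .
  have "(LINT y|lborel. p y * q y)\<^sup>2 \<le> (LINT y|lborel. (p y)\<^sup>2) * (LINT y|lborel. (q y)\<^sup>2)"
    by (rule integral_Cauchy_Schwarz[OF ip iq ipq])
  also have "(LINT y|lborel. (q y)\<^sup>2) = (LINT y::'a|lborel. exp (- norm y)) / (a / 2) ^ DIM('a)"
    unfolding q2 using a by (intro integral_exp_neg_norm(2)) simp
  finally show "(LINT y|lborel. exp (a / 4 * norm y) * norm (f y))\<^sup>2 \<le>
       (LINT y|lborel. exp (a * norm y) * (norm (f y))\<^sup>2) * ((LINT y::'a|lborel. exp (- norm y)) / (a / 2) ^ DIM('a))"
    unfolding pq p2 .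
qed

text \<open>
  For complex \<open>\<zeta>\<close> the kernel grows at most like \<open>exp (\<bar>Im \<zeta>\<bar> * norm v * norm y / (2 * T))\<close>, which the
  weight \<open>exp (a / 4 * norm y)\<close> dominates as long as \<open>\<bar>Im \<zeta>\<bar> * norm v \<le> a * T / 2\<close>.
\<close>

lemma scaled_fourier_extends_along_line:
  fixes f :: "'a::euclidean_space \<Rightarrow> complex" and x v :: 'a and a T H s :: real
  defines "h \<equiv> \<lambda>\<zeta>. LINT y|lborel. exp (- \<i> * (of_real (x \<bullet> y) + \<zeta> * of_real (v \<bullet> y)) / of_real (2 * T)) * f y"
  assumes [measurable]: "f \<in> borel_measurable borel" and T: "0 < T"
    and w: "integrable lborel (\<lambda>y. exp (a / 4 * norm y) * norm (f y))"
    and H: "H * norm v \<le> a * T / 2"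
  shows "h holomorphic_on {z. \<bar>Im z\<bar> < H}"
    and "\<And>z. \<bar>Im z\<bar> < H \<Longrightarrow> norm (h z) \<le> (LINT y|lborel. exp (a / 4 * norm y) * norm (f y))"
    and "h (of_real s) = scaled_fourier T f (x + s *\<^sub>R v)"
proof -
  let ?k = "\<lambda>z y. exp (- \<i> * (of_real (x \<bullet> y) + z * of_real (v \<bullet> y)) / of_real (2 * T)) * f y"
  have kb: "norm (?k z y) \<le> exp (a / 4 * norm y) * norm (f y)" if z: "\<bar>Im z\<bar> < H" for z y
  proof -
    have "Re (- \<i> * (of_real (x \<bullet> y) + z * of_real (v \<bullet> y)) / of_real (2 * T)) = Im z * (v \<bullet> y) / (2 * T)"
      by simp
    also have "\<dots> \<le> \<bar>Im z\<bar> * \<bar>v \<bullet> y\<bar> / (2 * T)"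
      using T by (intro divide_right_mono) (auto simp flip: abs_mult)
    also have "\<dots> \<le> H * (norm v * norm y) / (2 * T)"
      using T z by (intro divide_right_mono mult_mono Cauchy_Schwarz_ineq2) auto
    also have "\<dots> \<le> (a * T / 2) * norm y / (2 * T)"
      using T mult_right_mono[OF H norm_ge_zero[of y]] by (intro divide_right_mono) (auto simp: mult.assoc)
    also have "\<dots> = a / 4 * norm y" using T by simp
    finally show ?thesis unfolding norm_mult norm_exp_eq_Re by (intro mult_right_mono) auto
  qed
  show "h holomorphic_on {z. \<bar>Im z\<bar> < H}"
    unfolding h_def
  proof (rule holomorphic_on_integral_parameter)
    fix z0 assume z0: "z0 \<in> {z. \<bar>Im z\<bar> < H}"
    have "open {z. \<bar>Im z\<bar> < H}" by (intro open_Collect_less continuous_intros)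
    then obtain \<rho> where "0 < \<rho>" "ball z0 \<rho> \<subseteq> {z. \<bar>Im z\<bar> < H}"
      using z0 openE by blast
    then show "\<exists>\<rho>>0. \<exists>w. integrable lborel w \<and> ball z0 \<rho> \<subseteq> {z. \<bar>Im z\<bar> < H} \<and>
      (\<forall>z\<in>ball z0 \<rho>. \<forall>y\<in>space lborel. norm (?k z y) \<le> w y)"
      using w kb by blast
  qed (use T in \<open>auto intro!: holomorphic_intros\<close>)
  show "norm (h z) \<le> (LINT y|lborel. exp (a / 4 * norm y) * norm (f y))" if z: "\<bar>Im z\<bar> < H" for z
  proof -
    have k: "integrable lborel (?k z)"
      by (rule Bochner_Integration.integrable_bound[OF w]) (use order_trans[OF kb[OF z] abs_ge_self] in auto)
    have "norm (h z) \<le> (LINT y|lborel. norm (?k z y))"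
      unfolding h_def by (rule integral_norm_bound)
    also have "\<dots> \<le> (LINT y|lborel. exp (a / 4 * norm y) * norm (f y))"
      by (rule integral_mono[OF integrable_norm[OF k] w kb[OF z]])
    finally show ?thesis .
  qed
  show "h (of_real s) = scaled_fourier T f (x + s *\<^sub>R v)"
    by (simp add: h_def scaled_fourier_def inner_add_left)
qed

text \<open>
  The degenerate line with direction 0 through \<open>z\<close>.
\<close>

lemma scaled_fourier_sup_bound:
  fixes f :: "'a::euclidean_space \<Rightarrow> complex"
  assumes f: "f \<in> borel_measurable borel" and T: "0 < T" and a: "0 < a"
    and w: "integrable lborel (\<lambda>y. exp (a / 4 * norm y) * norm (f y))"
  shows "norm (scaled_fourier T f z) \<le> (LINT y|lborel. exp (a / 4 * norm y) * norm (f y))"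
  using scaled_fourier_extends_along_line(2)[OF f T w, of 1 0 0 z]
    scaled_fourier_extends_along_line(3)[OF f T w, of 1 0 z 0] T a
  by simp

section \<open>Smallness propagates from a ball\<close>

text \<open>
  Points of the half ball move by at most \<open>r / 2\<close>, so they stay in the full ball, and the Jacobian of a
  homothety of ratio \<open>s \<ge> 1\<close> only helps.
\<close>

lemma homothety_integral_le:
  fixes g :: "'a::euclidean_space \<Rightarrow> real"
  assumes [measurable]: "g \<in> borel_measurable borel" and g0: "\<And>z. 0 \<le> g z"
    and G: "integrable lborel (\<lambda>z. indicator (cball x0 r) z * g z)"
    and s: "1 \<le> s" "\<And>y. y \<in> ball x0 (r / 2) \<Longrightarrow> \<bar>s - 1\<bar> * norm (y - x) \<le> r / 2"
  shows homothety_integrable: "integrable lborel (\<lambda>y. indicator (ball x0 (r / 2)) y * g (x + s *\<^sub>R (y - x)))"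
    and "(LINT y|lborel. indicator (ball x0 (r / 2)) y * g (x + s *\<^sub>R (y - x)))
       \<le> (LINT z|lborel. indicator (cball x0 r) z * g z)"
proof -
  have [measurable]: "cball x0 r \<in> sets borel" "ball x0 (r / 2) \<in> sets borel" by auto
  define G' where "G' = (\<lambda>z. indicator (cball x0 r) z * g z)"
  define t where "t = x - s *\<^sub>R x"
  have [measurable]: "G' \<in> borel_measurable borel" unfolding G'_def
    by (intro borel_measurable_times borel_measurable_indicator) auto
  have iG: "integrable lborel (\<lambda>y. G' (t + s *\<^sub>R y))"
    using integrable_lborel_affine_iff[of G' s t] G s(1) by (simp add: G'_def)
  have le: "indicator (ball x0 (r / 2)) y * g (x + s *\<^sub>R (y - x)) \<le> G' (t + s *\<^sub>R y)" for y
  proof (cases "y \<in> ball x0 (r / 2)")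
    case True
    have e: "t + s *\<^sub>R y = x + s *\<^sub>R (y - x)" by (simp add: t_def algebra_simps)
    have "x + s *\<^sub>R (y - x) - x0 = (y - x0) + (s - 1) *\<^sub>R (y - x)" by (simp add: algebra_simps)
    then have "norm (x + s *\<^sub>R (y - x) - x0) \<le> norm (y - x0) + \<bar>s - 1\<bar> * norm (y - x)"
      by (metis norm_triangle_ineq norm_scaleR)
    also have "\<dots> \<le> r" using s(2)[OF True] True by (simp add: dist_norm norm_minus_commute)
    finally have "t + s *\<^sub>R y \<in> cball x0 r" unfolding e by (simp add: dist_norm norm_minus_commute)
    then show ?thesis using True by (simp add: G'_def e)
  qed (simp add: G'_def g0)
  show int: "integrable lborel (\<lambda>y. indicator (ball x0 (r / 2)) y * g (x + s *\<^sub>R (y - x)))"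
  proof (rule Bochner_Integration.integrable_bound[OF iG])
    show "AE y in lborel. norm (indicator (ball x0 (r / 2)) y * g (x + s *\<^sub>R (y - x))) \<le> norm (G' (t + s *\<^sub>R y))"
      by (rule AE_I2) (use le g0 in \<open>auto simp: abs_mult intro: order_trans[OF _ abs_ge_self]\<close>)
  qed measurable
  have "(LINT y|lborel. indicator (ball x0 (r / 2)) y * g (x + s *\<^sub>R (y - x))) \<le> (LINT y|lborel. G' (t + s *\<^sub>R y))"
    by (rule integral_mono[OF int iG le])
  also have "\<dots> \<le> s ^ DIM('a) * (LINT y|lborel. G' (t + s *\<^sub>R y))"
  proof -
    have "0 \<le> (LINT y|lborel. G' (t + s *\<^sub>R y))"
      by (intro integral_nonneg_AE AE_I2) (simp add: G'_def g0)
    then show ?thesis using one_le_power[OF s(1), of "DIM('a)"] by (simp add: mult_le_cancel_right1)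
  qed
  also have "\<dots> = (LINT z|lborel. G' z)"
    using integral_lborel_affine(2)[of G' s t] s(1) by simp
  finally show "(LINT y|lborel. indicator (ball x0 (r / 2)) y * g (x + s *\<^sub>R (y - x)))
       \<le> (LINT z|lborel. indicator (cball x0 r) z * g z)" by (simp add: G'_def)
qed

text \<open>
  The nodes are the same for every \<open>y\<close>. Integrating the hypothesis over the half ball therefore
  replaces each pointwise value by an integral over a homothetic image of that ball.
\<close>

lemma average_of_homotheties:
  fixes g :: "'a::euclidean_space \<Rightarrow> real" and s :: "nat \<Rightarrow> real"
  assumes g: "g \<in> borel_measurable borel" "\<And>z. 0 \<le> g z"
    and G: "integrable lborel (\<lambda>z. indicator (cball x0 r) z * g z)"
    and r: "0 < r" and K: "0 \<le> K" and J: "finite J"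
    and s: "\<And>j. j \<in> J \<Longrightarrow> 1 \<le> s j"
      "\<And>j y. j \<in> J \<Longrightarrow> y \<in> ball x0 (r / 2) \<Longrightarrow> \<bar>s j - 1\<bar> * norm (y - x) \<le> r / 2"
    and le: "\<And>y. y \<in> ball x0 (r / 2) \<Longrightarrow> c \<le> P + K * (\<Sum>j\<in>J. g (x + s j *\<^sub>R (y - x)))"
  shows "c \<le> P + K * real (card J) * (LINT z|lborel. indicator (cball x0 r) z * g z) / measure lborel (ball x0 (r / 2))"
proof -
  let ?B = "ball x0 (r / 2)"
  let ?N = "LINT z|lborel. indicator (cball x0 r) z * g z"
  have V: "0 < measure lborel ?B" using r by (simp add: content_ball_pos)
  have iB: "integrable lborel (indicator ?B :: 'a \<Rightarrow> real)"
    using emeasure_lborel_ball_finite by (simp add: integrable_indicator_iff less_top)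
  note hint = homothety_integrable[OF g G s]
  have "(c - P) * measure lborel ?B = (LINT y|lborel. (c - P) * indicator ?B y)" by simp
  also have "\<dots> \<le> (LINT y|lborel. K * (\<Sum>j\<in>J. indicator ?B y * g (x + s j *\<^sub>R (y - x))))"
  proof (rule integral_mono)
    show "integrable lborel (\<lambda>y. (c - P) * indicator ?B y)" using iB by simp
    show "integrable lborel (\<lambda>y. K * (\<Sum>j\<in>J. indicator ?B y * g (x + s j *\<^sub>R (y - x))))"
      using hint by (intro integrable_mult_right Bochner_Integration.integrable_sum)
    show "(c - P) * indicator ?B y \<le> K * (\<Sum>j\<in>J. indicator ?B y * g (x + s j *\<^sub>R (y - x)))" for y
      using le[of y] by (cases "y \<in> ?B") auto
  qed
  also have "\<dots> = K * (\<Sum>j\<in>J. LINT y|lborel. indicator ?B y * g (x + s j *\<^sub>R (y - x)))"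
    using hint by (simp add: Bochner_Integration.integral_sum)
  also have "\<dots> \<le> K * (\<Sum>j\<in>J. ?N)"
    using K by (intro mult_left_mono sum_mono homothety_integral_le(2)[OF g G s])
  finally have "(c - P) * measure lborel ?B \<le> K * real (card J) * ?N" by (simp add: mult.assoc)
  then have "c - P \<le> K * real (card J) * ?N / measure lborel ?B" using V by (simp add: pos_le_divide_eq)
  then show ?thesis by simp
qed

text \<open>
  The strip bound is applied on the complex line through \<open>x\<close> and \<open>y\<close>, squared, and averaged over \<open>y\<close>.
  The half-width \<open>R / (2 * \<Lambda>)\<close> serves two purposes: \<open>R \<le> a * T\<close> keeps the strip inside the
  tube where the transform is bounded, and \<open>R \<le> r\<close> keeps the nodes inside the ball.
\<close>

lemma scaled_fourier_pointwise_bound: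
  fixes f :: "'a::euclidean_space \<Rightarrow> complex" and x x0 :: 'a and a r T \<Lambda> :: real and m :: nat
  defines "g \<equiv> scaled_fourier T f" and "R \<equiv> min (a * T) r"
    and "A \<equiv> LINT y|lborel. exp (a / 4 * norm y) * norm (f y)"
  assumes f: "f \<in> borel_measurable borel" and T: "0 < T" and a: "0 < a" and r: "0 < r" and m: "1 \<le> m"
    and w: "integrable lborel (\<lambda>y. exp (a / 4 * norm y) * norm (f y))"
    and L: "0 < \<Lambda>" "\<And>y. y \<in> ball x0 (r / 2) \<Longrightarrow> norm (y - x) \<le> \<Lambda>"
  shows "(norm (g x))\<^sup>2 \<le> 2 * A\<^sup>2 * exp (- (2 * real m * exp (- pi / 2 - pi * \<Lambda> / R)))
       + 8 * (real m)\<^sup>2 * (3 * real m) ^ (2 * m) * (LINT z|lborel. indicator (cball x0 r) z * (norm (g z))\<^sup>2)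
          / measure lborel (ball x0 (r / 2))"
proof -
  have gA: "norm (g z) \<le> A" for z
    unfolding g_def A_def by (rule scaled_fourier_sup_bound[OF f T a w])
  define H where "H = R / (2 * \<Lambda>)"
  define \<delta> where "\<delta> = exp (- pi / 2 - pi * \<Lambda> / R)"
  have R: "0 < R" "R \<le> a * T" "R \<le> r" using T a r by (auto simp: R_def)
  have H: "0 < H" "H * \<Lambda> = R / 2" "pi / (2 * H) = pi * \<Lambda> / R"
    using R L by (auto simp: H_def field_simps)
  have [measurable]: "g \<in> borel_measurable borel" unfolding g_def using f by measurable
  have [measurable]: "cball x0 r \<in> sets borel" "ball x0 (r / 2) \<in> sets borel" by auto
  define s where "s = (\<lambda>j::nat. 1 + H * real j / real m)"
  have s1: "1 \<le> s j" for j using H by (simp add: s_def)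
  have sH: "\<bar>s j - 1\<bar> \<le> H" if "j \<in> {1..m}" for j
    using that H(1) m by (auto simp: s_def abs_of_nonneg field_simps)
  have "(norm (g x))\<^sup>2 \<le> 2 * A\<^sup>2 * exp (- (2 * real m * \<delta>)) +
     8 * real m * (3 * real m) ^ (2 * m) * real (card {1..m}) * (LINT z|lborel. indicator (cball x0 r) z * (norm (g z))\<^sup>2)
          / measure lborel (ball x0 (r / 2))"
  proof (rule average_of_homotheties[where s = s and x = x])
    show "(\<lambda>z. (norm (g z))\<^sup>2) \<in> borel_measurable borel" by measurable
    show "integrable lborel (\<lambda>z. indicator (cball x0 r) z * (norm (g z))\<^sup>2)"
    proof (rule Bochner_Integration.integrable_bound)
      show "integrable lborel (\<lambda>z. A\<^sup>2 * indicator (cball x0 r) z)"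
        using emeasure_lborel_cball_finite[of x0 r] by (simp add: integrable_indicator_iff less_top)
      show "AE z in lborel. norm (indicator (cball x0 r) z * (norm (g z))\<^sup>2) \<le> norm (A\<^sup>2 * indicator (cball x0 r) z)"
        by (rule AE_I2) (auto simp: indicator_def intro: power_mono gA)
    qed measurable
    show "\<bar>s j - 1\<bar> * norm (y - x) \<le> r / 2" if "j \<in> {1..m}" "y \<in> ball x0 (r / 2)" for j y
    proof -
      have "\<bar>s j - 1\<bar> * norm (y - x) \<le> H * \<Lambda>"
        using H by (intro mult_mono sH that L) auto
      then show ?thesis using H R by linarith
    qed
    fix y assume y: "y \<in> ball x0 (r / 2)"
    define h where "h = (\<lambda>\<zeta>. LINT w|lborel. exp (- \<i> * (of_real (x \<bullet> w) + \<zeta> * of_real ((y - x) \<bullet> w)) / of_real (2 * T)) * f w)"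
    have "H * norm (y - x) \<le> H * \<Lambda>" using H L(2)[OF y] by simp
    then have Hv: "H * norm (y - x) \<le> a * T / 2" using H R by linarith
    note ext = scaled_fourier_extends_along_line[OF f T w Hv]
    have h_hol: "h holomorphic_on {z. \<bar>Im z\<bar> < H}" unfolding h_def by (rule ext(1))
    have h_bound: "norm (h z) \<le> A" if "\<bar>Im z\<bar> < H" for z
      unfolding h_def A_def by (rule ext(2)[OF that])
    have h_real: "h (of_real \<sigma>) = g (x + \<sigma> *\<^sub>R (y - x))" for \<sigma>
      unfolding h_def g_def by (rule ext(3))
    define \<Sigma> where "\<Sigma> = (\<Sum>j=1..m. norm (g (x + s j *\<^sub>R (y - x))))"
    have "norm (h 0) \<le> A * exp (- (real m * exp (- pi / 2 - pi / (2 * H)))) + 2 * (3 * real m) ^ m *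
        (\<Sum>j=1..m. norm (h (of_real (1 + H * real j / real m))))"
      by (rule strip_interpolation_bound[OF H(1) m h_hol h_bound])
    also have "h 0 = g x" using h_real[of 0] by simp
    finally have "norm (g x) \<le> A * exp (- (real m * \<delta>)) + 2 * (3 * real m) ^ m * \<Sigma>"
      unfolding h_real H(3) \<delta>_def \<Sigma>_def s_def .
    then have "(norm (g x))\<^sup>2 \<le> (A * exp (- (real m * \<delta>)) + 2 * (3 * real m) ^ m * \<Sigma>)\<^sup>2"
      by (intro power_mono) auto
    also have "\<dots> \<le> 2 * (A * exp (- (real m * \<delta>)))\<^sup>2 + 2 * (2 * (3 * real m) ^ m * \<Sigma>)\<^sup>2"
      using sum_squares_bound[of "A * exp (- (real m * \<delta>))" "2 * (3 * real m) ^ m * \<Sigma>"] by (simp add: power2_sum)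
    also have "(A * exp (- (real m * \<delta>)))\<^sup>2 = A\<^sup>2 * exp (- (2 * real m * \<delta>))"
      by (simp add: power_mult_distrib flip: exp_of_nat_mult)
    also have "(2 * (3 * real m) ^ m * \<Sigma>)\<^sup>2 = 4 * (3 * real m) ^ (2 * m) * \<Sigma>\<^sup>2"
      by (simp add: power_mult_distrib power_mult[symmetric] mult.commute)
    also have "\<Sigma>\<^sup>2 \<le> (\<Sum>j=1..m. (norm (g (x + s j *\<^sub>R (y - x))))\<^sup>2) * real m"
      unfolding \<Sigma>_def using sum_squared_le_sum_of_squares[of "\<lambda>j. norm (g (x + s j *\<^sub>R (y - x)))" "{1..m}"] by simp
    finally show "(norm (g x))\<^sup>2 \<le> 2 * A\<^sup>2 * exp (- (2 * real m * \<delta>)) +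
       8 * real m * (3 * real m) ^ (2 * m) * (\<Sum>j=1..m. (norm (g (x + s j *\<^sub>R (y - x))))\<^sup>2)"
      by (simp add: mult_left_mono mult.assoc) (simp add: mult_ac)
  qed (use s1 r in auto)
  then show "(norm (g x))\<^sup>2 \<le> 2 * A\<^sup>2 * exp (- (2 * real m * exp (- pi / 2 - pi * \<Lambda> / R)))
       + 8 * (real m)\<^sup>2 * (3 * real m) ^ (2 * m) * (LINT z|lborel. indicator (cball x0 r) z * (norm (g z))\<^sup>2)
          / measure lborel (ball x0 (r / 2))"
    by (simp add: \<delta>_def power2_eq_square mult_ac)
qed
text \<open>
  Both bounds carry over from \<open>scaled_fourier\<close> by dividing by \<open>(4 * pi * T) ^ CARD('n)\<close>. The
  powers of \<open>a / 2\<close> from Cauchy-Schwarz and of \<open>4 * pi * T\<close> combine to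
  \<open>(2 * pi * (a * T)) ^ CARD('n)\<close>, which is at least \<open>R ^ CARD('n)\<close>.
\<close>

lemma schrodinger_evolution_bounds:
  fixes u0 :: "real ^ 'n \<Rightarrow> complex" and x0 :: "real ^ 'n" and a r T :: real
  defines "U \<equiv> \<lambda>x. (norm (schrodinger_evolution u0 x T))\<^sup>2" and "R \<equiv> min (a * T) r"
    and "E0 \<equiv> LINT y::real^'n|lborel. exp (- norm y)"
    and "M \<equiv> LINT y|lborel. exp (a * norm y) * (norm (u0 y))\<^sup>2"
  assumes u0: "smooth_compact_support u0" and T: "0 < T" and a: "0 < a" and r: "0 < r"
  shows "U \<in> borel_measurable borel"
    and "U x \<le> M * E0 / R ^ CARD('n)"
    and "\<And>m x \<Lambda>. 1 \<le> m \<Longrightarrow> 0 < \<Lambda> \<Longrightarrow> (\<And>y. y \<in> ball x0 (r / 2) \<Longrightarrow> norm (y - x) \<le> \<Lambda>) \<Longrightarrow>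
      U x \<le> 2 * (M * E0 / R ^ CARD('n)) * exp (- (2 * real m * exp (- pi / 2 - pi * \<Lambda> / R))) +
        8 * (real m)\<^sup>2 * (3 * real m) ^ (2 * m) * (LINT z:cball x0 r|lborel. U z) /
          (unit_ball_vol (real CARD('n)) * (r / 2) ^ CARD('n))"
proof -
  note u0' = smooth_compact_supportD[OF u0]
  have R: "0 < R" "R \<le> a * T" using T a r by (auto simp: R_def)
  have E0: "0 \<le> E0" unfolding E0_def by simp
  have M: "0 \<le> M" unfolding M_def by simp
  obtain f where fm [measurable]: "f \<in> borel_measurable borel" and nf: "\<And>y. norm (f y) \<le> norm (u0 y)"
    and Uf: "\<And>x. (norm (schrodinger_evolution u0 x T))\<^sup>2 = (norm (scaled_fourier T f x))\<^sup>2 / (4 * pi * T) ^ CARD('n)"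
    using schrodinger_evolution_as_scaled_fourier[OF u0'(2) T] by metis
  define g where "g = scaled_fourier T f"
  define A where "A = (LINT y|lborel. exp (a / 4 * norm y) * norm (f y))"
  define k where "k = (4 * pi * T) ^ CARD('n)"
  have k: "0 < k" using T by (simp add: k_def)
  have U: "U x = (norm (g x))\<^sup>2 / k" for x unfolding U_def g_def k_def by (rule Uf)
  show "U \<in> borel_measurable borel"
    unfolding U[abs_def] g_def by measurable
  have le: "exp (a * norm y) * (norm (f y))\<^sup>2 \<le> exp (a * norm y) * (norm (u0 y))\<^sup>2" for y
    using nf[of y] by (intro mult_left_mono power_mono) auto
  have fM: "integrable lborel (\<lambda>y. exp (a * norm y) * (norm (f y))\<^sup>2)"
    by (rule Bochner_Integration.integrable_bound[OF u0'(3)[of a]]) (use le in auto)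
  have MM: "(LINT y|lborel. exp (a * norm y) * (norm (f y))\<^sup>2) \<le> M"
    unfolding M_def by (rule integral_mono[OF fM u0'(3) le])
  note w = integrable_exponential_weight_L1[OF fm a fM]
  have "A\<^sup>2 \<le> (LINT y|lborel. exp (a * norm y) * (norm (f y))\<^sup>2) * (E0 / (a / 2) ^ CARD('n))"
    using exponential_weight_L1_L2(2)[OF fm a fM] by (simp add: A_def E0_def)
  also have "\<dots> \<le> M * (E0 / (a / 2) ^ CARD('n))"
    using MM E0 a by (intro mult_right_mono) auto
  finally have "A\<^sup>2 / k \<le> M * (E0 / (a / 2) ^ CARD('n)) / k"
    using k by (intro divide_right_mono) auto
  also have "\<dots> = M * E0 / (2 * pi * (a * T)) ^ CARD('n)"
    using a T by (simp add: k_def power_divide power_mult_distrib[symmetric] mult_ac)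
       (simp add: field_simps flip: power_mult_distrib)
  also have "\<dots> \<le> M * E0 / R ^ CARD('n)"
  proof (intro divide_left_mono power_mono mult_nonneg_nonneg)
    have "1 * R \<le> (2 * pi) * (a * T)"
      using R pi_gt3 by (intro mult_mono) auto
    then show "R \<le> 2 * pi * (a * T)" by simp
  qed (use R M E0 a T in auto)
  finally have Ak: "A\<^sup>2 / k \<le> M * E0 / R ^ CARD('n)" .
  show "U x \<le> M * E0 / R ^ CARD('n)"
  proof -
    have "norm (g x) \<le> A" unfolding g_def A_def by (rule scaled_fourier_sup_bound[OF fm T a w])
    then have "U x \<le> A\<^sup>2 / k" unfolding U using k by (intro divide_right_mono power_mono) auto
    with Ak show ?thesis by linarith
  qed
  fix m :: nat and x :: "real ^ 'n" and \<Lambda> :: real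
  assume m: "1 \<le> m" and L: "0 < \<Lambda>" "\<And>y. y \<in> ball x0 (r / 2) \<Longrightarrow> norm (y - x) \<le> \<Lambda>"
  let ?K = "8 * (real m)\<^sup>2 * (3 * real m) ^ (2 * m)"
  let ?e = "exp (- (2 * real m * exp (- pi / 2 - pi * \<Lambda> / R)))"
  let ?V = "unit_ball_vol (real CARD('n)) * (r / 2) ^ CARD('n)"
  let ?N = "LINT z|lborel. indicator (cball x0 r) z * (norm (g z))\<^sup>2"
  have V: "measure lborel (ball x0 (r / 2)) = ?V" using r by (simp add: content_ball)
  have N: "(LINT z:cball x0 r|lborel. U z) = ?N / k"
    unfolding set_lebesgue_integral_def U by simp
  have "(norm (g x))\<^sup>2 \<le> 2 * A\<^sup>2 * ?e + ?K * ?N / ?V"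
    unfolding V[symmetric] g_def A_def R_def
    by (rule scaled_fourier_pointwise_bound[OF fm T a r m w L])
  then have "U x \<le> (2 * A\<^sup>2 * ?e + ?K * ?N / ?V) / k"
    unfolding U using k by (intro divide_right_mono) auto
  also have "\<dots> = 2 * (A\<^sup>2 / k) * ?e + ?K * (?N / k) / ?V"
    by (simp add: add_divide_distrib)
  also have "\<dots> \<le> 2 * (M * E0 / R ^ CARD('n)) * ?e + ?K * (?N / k) / ?V"
    using Ak by (intro add_right_mono mult_right_mono mult_left_mono) auto
  finally show "U x \<le> 2 * (M * E0 / R ^ CARD('n)) * ?e + ?K * (LINT z:cball x0 r|lborel. U z) / ?V"
    unfolding N .
qed

section \<open>Choice of parameters\<close>

text \<open>
  Here \<open>l\<close> stands for \<open>ln (1 / \<epsilon>)\<close>. The choice is \<open>m = \<lceil>l / \<delta>\<rceil>\<close>. Since \<open>D < l / 64\<close>, the factor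
  \<open>exp (4 * D)\<close>, the logarithm \<open>l\<close> and all numerical constants are bounded by small powers of
  \<open>exp l\<close>. This leaves \<open>(real m)\<^sup>2\<close> below \<open>exp (l / 2 + 16 * \<beta> * l)\<close>, and the remaining
  half power of \<open>exp l\<close> absorbs the constant 11 and the factor \<open>exp (- l)\<close>.
\<close>

lemma exists_number_of_nodes:
  fixes l D \<beta> \<delta> :: real
  assumes D: "1 \<le> D" and l: "64 * D < l" and \<beta>: "0 \<le> \<beta>"
    and \<delta>: "0 < \<delta>" "inverse \<delta> \<le> exp (4 * D + 8 * \<beta> * l)"
  obtains m :: nat where "1 \<le> m" "exp (- (2 * real m * \<delta>)) \<le> exp (- l)"
    "8 * (real m)\<^sup>2 * (3 * real m) ^ (2 * m) \<le> exp (- l) * exp (exp (l * (1 + 16 * \<beta>)))"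
proof -
  have l0: "64 < l" using D l by simp
  define m where "m = nat \<lceil>l * inverse \<delta>\<rceil>"
  have pos: "0 < l * inverse \<delta>" using l0 \<delta> by simp
  have m_ge: "l * inverse \<delta> \<le> real m" unfolding m_def by (rule real_nat_ceiling_ge)
  have m_le: "real m \<le> l * inverse \<delta> + 1" unfolding m_def using pos by linarith
  have m1: "1 \<le> m" using m_ge pos by (cases m) auto
  have small: "exp (- (2 * real m * \<delta>)) \<le> exp (- l)"
  proof -
    have "l \<le> real m * \<delta>" using m_ge \<delta>(1) by (simp add: field_simps)
    then show ?thesis using l0 by simp
  qed
  define Y where "Y = exp (l / 8 + 8 * \<beta> * l)"
  have Y1: "1 \<le> Y" using l0 \<beta> by (simp add: Y_def)
  have "l * inverse \<delta> \<le> (16 * exp (l / 16)) * exp (l / 16 + 8 * \<beta> * l)"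
  proof (rule mult_mono)
    show "l \<le> 16 * exp (l / 16)" using exp_ge_add_one_self[of "l / 16"] by linarith
    have "exp (4 * D + 8 * \<beta> * l) \<le> exp (l / 16 + 8 * \<beta> * l)" using l by simp
    then show "inverse \<delta> \<le> exp (l / 16 + 8 * \<beta> * l)" using \<delta>(2) by linarith
  qed (use \<delta> in auto)
  also have "\<dots> = 16 * Y" by (simp add: Y_def mult.assoc flip: exp_add)
  finally have "real m \<le> 17 * Y" using m_le Y1 by linarith
  also have "\<dots> \<le> exp (l / 8) * Y"
  proof -
    have "5 * 5 \<le> exp 4 * exp (4::real)"
      using exp_ge_add_one_self[of "4::real"] by (intro mult_mono) auto
    also have "\<dots> = exp 8" by (simp flip: exp_add)
    also have "\<dots> \<le> exp (l / 8)" using l0 by simp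
    finally show ?thesis using Y1 by (intro mult_right_mono) auto
  qed
  also have "\<dots> = exp (l / 4 + 8 * \<beta> * l)" by (simp add: Y_def flip: exp_add)
  finally have "real m \<le> exp (l / 4 + 8 * \<beta> * l)" .
  then have "(real m)\<^sup>2 \<le> (exp (l / 4 + 8 * \<beta> * l))\<^sup>2" by (intro power_mono) auto
  also have "\<dots> = exp (l / 2 + 16 * \<beta> * l)" by (simp add: algebra_simps flip: exp_of_nat_mult)
  finally have m2: "(real m)\<^sup>2 \<le> exp (l / 2 + 16 * \<beta> * l)" .
  have K: "8 * (real m)\<^sup>2 * (3 * real m) ^ (2 * m) \<le> exp (11 * (real m)\<^sup>2)"
  proof -
    let ?x = "real m"
    have x: "1 \<le> ?x" using m1 by simp
    have xx: "?x \<le> ?x\<^sup>2" "1 \<le> ?x\<^sup>2" using x self_le_power[of ?x 2] by auto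
    have "2 ^ 3 \<le> (exp 1 :: real) ^ 3"
      using exp_ge_add_one_self[of "1::real"] by (intro power_mono) auto
    then have "8 \<le> exp (3::real)" by (simp flip: exp_of_nat_mult)
    also have "\<dots> \<le> exp (3 * ?x\<^sup>2)" using xx by simp
    finally have k1: "8 \<le> exp (3 * ?x\<^sup>2)" .
    have "?x \<le> exp (?x\<^sup>2)" using exp_ge_add_one_self[of "?x\<^sup>2"] xx by linarith
    then have "?x\<^sup>2 \<le> (exp (?x\<^sup>2))\<^sup>2" by (intro power_mono) auto
    then have k2: "?x\<^sup>2 \<le> exp (2 * ?x\<^sup>2)" by (simp flip: exp_of_nat_mult)
    have "3 * ?x \<le> exp (3 * ?x)" using exp_ge_add_one_self[of "3 * ?x"] by linarith
    then have "(3 * ?x) ^ (2 * m) \<le> exp (3 * ?x) ^ (2 * m)" by (intro power_mono) auto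
    also have "\<dots> = exp (6 * ?x\<^sup>2)" by (simp add: power2_eq_square mult_ac flip: exp_of_nat_mult)
    finally have k3: "(3 * ?x) ^ (2 * m) \<le> exp (6 * ?x\<^sup>2)" .
    have "8 * ?x\<^sup>2 * (3 * ?x) ^ (2 * m) \<le> exp (3 * ?x\<^sup>2) * exp (2 * ?x\<^sup>2) * exp (6 * ?x\<^sup>2)"
      by (intro mult_mono k1 k2 k3) auto
    then show ?thesis by (simp flip: exp_add)
  qed
  have "11 * (real m)\<^sup>2 \<le> - l + exp (l * (1 + 16 * \<beta>))"
  proof -
    define Z where "Z = exp (l / 2 + 16 * \<beta> * l)"
    have "l \<le> 2 * exp (l / 2)" using exp_ge_add_one_self[of "l / 2"] by linarith
    also have "\<dots> \<le> 2 * Z" using \<beta> l0 by (simp add: Z_def)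
    finally have lZ: "l \<le> 2 * Z" .
    have "13 \<le> exp (l / 2)" using exp_ge_add_one_self[of "l / 2"] l0 by linarith
    then have "13 * Z \<le> exp (l / 2) * Z" by (intro mult_right_mono) (auto simp: Z_def)
    also have "\<dots> = exp (l * (1 + 16 * \<beta>))" by (simp add: Z_def algebra_simps flip: exp_add)
    finally show ?thesis using m2 lZ unfolding Z_def[symmetric] by linarith
  qed
  then have "exp (11 * (real m)\<^sup>2) \<le> exp (- l) * exp (exp (l * (1 + 16 * \<beta>)))"
    by (simp flip: exp_add)
  with m1 small K that show thesis by (meson order_trans)
qed

text \<open>
  The estimate with an explicit constant. In \<open>C\<close> the summand 64 pays for the case of large
  \<open>\<epsilon>\<close>, and \<open>1 + CARD('n) + P\<close> pays for the volume factors \<open>P * (1 / (b * R)) ^ CARD('n)\<close>.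
\<close>

lemma observability_at_one_time:
  fixes x0 x' :: "real ^ 'n" and r a b T \<epsilon> :: real and u0 :: "real ^ 'n \<Rightarrow> complex"
  defines "E0 \<equiv> LINT y::real^'n|lborel. exp (- norm y)"
    and "R \<equiv> min (a * T) r" and "V \<equiv> unit_ball_vol (real CARD('n))"
  defines "P \<equiv> 2 ^ CARD('n) * (3 * E0\<^sup>2 + E0 / V)"
  defines "C \<equiv> 65 + real CARD('n) + P"
  assumes r: "r > 0" and a: "a > 0" and b: "b > 0" and T: "T > 0"
    and u0: "smooth_compact_support u0" and \<epsilon>: "\<epsilon> \<in> {0<..<1}"
  shows "(LINT x|lborel. exp (- b * norm (x - x')) * (cmod (schrodinger_evolution u0 x T))\<^sup>2)
      \<le> exp (C * (1 + (norm (x0 - x') + r + inverse b) / R)) *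
        (\<epsilon> * (LINT x|lborel. exp (a * norm x) * (cmod (u0 x))\<^sup>2) +
         \<epsilon> * exp (\<epsilon> powr (- 1 - C * inverse b / R)) *
           (LINT x:cball x0 r|lborel. (cmod (schrodinger_evolution u0 x T))\<^sup>2))"
proof -
  let ?n = "CARD('n)"
  define U where "U = (\<lambda>x. (cmod (schrodinger_evolution u0 x T))\<^sup>2)"
  define M where "M = (LINT x|lborel. exp (a * norm x) * (cmod (u0 x))\<^sup>2)"
  define N where "N = (LINT x:cball x0 r|lborel. U x)"
  define D where "D = 1 + (norm (x0 - x') + r + inverse b) / R"
  define \<beta> where "\<beta> = inverse b / R"
  define B where "B = M * E0 / R ^ ?n"
  define l where "l = - ln \<epsilon>"
  define I where "I = (LINT x|lborel. exp (- b * norm (x - x')) * U x)"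
  have R: "0 < R" "R \<le> r" using r a T by (auto simp: R_def)
  have \<beta>: "0 < \<beta>" using b R by (simp add: \<beta>_def)
  have D: "1 \<le> D" "D = 1 + (norm (x0 - x') + r) / R + \<beta>" "1 + \<beta> \<le> D"
    using R r b by (auto simp: D_def \<beta>_def add_divide_distrib)
  have E0: "0 \<le> E0" unfolding E0_def by simp
  have V: "0 < V" unfolding V_def by simp
  have M: "0 \<le> M" unfolding M_def by simp
  have N: "0 \<le> N" unfolding N_def U_def set_lebesgue_integral_def by (intro integral_nonneg_AE AE_I2) auto
  have P: "0 \<le> P" using E0 V by (simp add: P_def)
  have B0: "0 \<le> B" using M E0 R by (simp add: B_def)
  have \<epsilon>': "0 < \<epsilon>" "\<epsilon> < 1" "\<epsilon> = exp (- l)" "0 < l" using \<epsilon> by (auto simp: l_def)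
  have Um: "U \<in> borel_measurable borel"
    unfolding U_def by (rule schrodinger_evolution_bounds(1)[OF u0 T a r])
  have U_sup: "U x \<le> B" for x
    unfolding U_def B_def M_def E0_def R_def by (rule schrodinger_evolution_bounds(2)[OF u0 T a r])
  have U_pw: "U x \<le> 2 * B * exp (- (2 * real m * exp (- pi / 2 - pi * \<Lambda> / R))) +
        8 * (real m)\<^sup>2 * (3 * real m) ^ (2 * m) * N / (V * (r / 2) ^ ?n)"
    if "1 \<le> m" "0 < \<Lambda>" "\<And>y. y \<in> ball x0 (r / 2) \<Longrightarrow> norm (y - x) \<le> \<Lambda>" for m x \<Lambda>
    unfolding U_def B_def M_def E0_def R_def N_def V_def
    by (rule schrodinger_evolution_bounds(3)[OF u0 T a r that])
  have U0: "0 \<le> U x" for x by (simp add: U_def)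
  have weighted: "I \<le> E0 / b ^ ?n * (Q + 2 ^ ?n * exp (- b * L / 2) * B)"
    if "0 \<le> Q" "\<And>x. norm (x - x') \<le> L \<Longrightarrow> U x \<le> Q" for Q L
    using exponentially_weighted_integral_le[OF Um b U0 U_sup that] by (simp add: I_def E0_def)
  have bR: "1 / (b ^ ?n * R ^ ?n) = \<beta> ^ ?n"
    by (simp add: \<beta>_def power_divide inverse_eq_divide power_mult_distrib mult.commute)
  have br: "1 / (b ^ ?n * r ^ ?n) \<le> \<beta> ^ ?n"
    unfolding bR[symmetric] using R b r by (intro divide_left_mono mult_left_mono power_mono) auto
  have pre: "P * \<beta> ^ ?n \<le> exp ((C - 64) * D)"
  proof -
    have "\<beta> ^ ?n \<le> exp \<beta> ^ ?n"
      using \<beta> exp_ge_add_one_self[of \<beta>] by (intro power_mono) linarith+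
    also have "\<dots> = exp (real ?n * \<beta>)" by (simp flip: exp_of_nat_mult)
    finally have "\<beta> ^ ?n \<le> exp (real ?n * \<beta>)" .
    moreover have "P \<le> exp P" using exp_ge_add_one_self[of P] by linarith
    ultimately have "P * \<beta> ^ ?n \<le> exp P * exp (real ?n * \<beta>)"
      using P \<beta> by (intro mult_mono) auto
    also have "\<dots> = exp (P * 1 + real ?n * \<beta>)" by (simp add: exp_add)
    also have "\<dots> \<le> exp ((C - 64) * D)"
    proof -
      have "P * 1 + real ?n * \<beta> \<le> P * D + real ?n * D"
        using P D by (intro add_mono mult_left_mono) auto
      also have "\<dots> \<le> (C - 64) * D" using D(1) by (simp add: C_def algebra_simps)
      finally show ?thesis by simp
    qed
    finally show ?thesis .
  qed
  have "I \<le> exp (C * D) * (\<epsilon> * M + \<epsilon> * exp (\<epsilon> powr (- 1 - C * inverse b / R)) * N)"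
  \<comment> \<open>For \<open>\<epsilon> \<ge> exp (- 64 * D)\<close> the prefactor makes up for the factor \<open>\<epsilon>\<close>, so the supremum
    bound is enough; otherwise the nodes are chosen according to \<open>\<epsilon>\<close>.\<close>
  proof (cases "l \<le> 64 * D")
    case True
    have "I \<le> E0 / b ^ ?n * (B + 2 ^ ?n * exp (- b * 0 / 2) * B)"
      by (rule weighted) (use B0 U_sup in auto)
    also have "\<dots> = (1 + 2 ^ ?n) * E0\<^sup>2 * (1 / (b ^ ?n * R ^ ?n)) * M"
      using b R by (simp add: B_def power2_eq_square field_simps)
    also have "\<dots> \<le> (P * \<beta> ^ ?n) * M"
      unfolding bR
    proof (intro mult_right_mono)
      have "1 + 2 ^ ?n \<le> 2 ^ ?n * (3::real)"
        using one_le_power[of "2::real" ?n] by linarith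
      then have "(1 + 2 ^ ?n) * E0\<^sup>2 \<le> 2 ^ ?n * (3 * E0\<^sup>2)"
        using mult_right_mono[of "1 + 2 ^ ?n" "2 ^ ?n * (3::real)" "E0\<^sup>2"] by (simp add: mult.assoc)
      also have "\<dots> \<le> P" unfolding P_def using E0 V by (intro mult_left_mono) auto
      finally show "(1 + 2 ^ ?n) * E0\<^sup>2 \<le> P" .
    qed (use \<beta> M in auto)
    also have "\<dots> \<le> exp ((C - 64) * D) * M" by (intro mult_right_mono pre M)
    also have "\<dots> \<le> (exp (C * D) * \<epsilon>) * M"
    proof (intro mult_right_mono M)
      show "exp ((C - 64) * D) \<le> exp (C * D) * \<epsilon>"
        unfolding \<epsilon>'(3) using True by (simp add: algebra_simps flip: exp_add)
    qed
    also have "\<dots> \<le> exp (C * D) * (\<epsilon> * M + \<epsilon> * exp (\<epsilon> powr (- 1 - C * inverse b / R)) * N)"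
      using \<epsilon>' N by (simp add: distrib_left)
    finally show ?thesis .
  next
    case False
    \<comment> \<open>The far region contributes \<open>exp (- b * L / 2) = \<epsilon>\<close>.\<close>
    define L where "L = 2 * l / b"
    define \<Lambda> where "\<Lambda> = L + norm (x0 - x') + r"
    define \<delta> where "\<delta> = exp (- pi / 2 - pi * \<Lambda> / R)"
    have L: "0 < L" "- b * L / 2 = - l" using \<epsilon>' b by (auto simp: L_def)
    have \<Lambda>: "0 < \<Lambda>" using L r by (simp add: \<Lambda>_def add_nonneg_pos add_pos_nonneg)
    have "inverse \<delta> \<le> exp (4 * D + 8 * \<beta> * l)"
    proof -
      have "pi * \<Lambda> / R = pi * ((norm (x0 - x') + r) / R) + pi * (2 * \<beta> * l)"
        by (simp add: \<Lambda>_def L_def \<beta>_def divide_inverse algebra_simps)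
      also have "\<dots> \<le> 4 * ((norm (x0 - x') + r) / R) + 4 * (2 * \<beta> * l)"
        using pi_less_4 r R \<beta> \<epsilon>' by (intro add_mono mult_right_mono) auto
      finally have "pi / 2 + pi * \<Lambda> / R \<le> 4 * D + 8 * \<beta> * l"
        using pi_less_4 \<beta> unfolding D(2) by simp
      moreover have "inverse \<delta> = exp (pi / 2 + pi * \<Lambda> / R)"
        by (simp add: \<delta>_def flip: exp_minus)
      ultimately show ?thesis by simp
    qed
    then obtain m :: nat where m: "1 \<le> m" "exp (- (2 * real m * \<delta>)) \<le> exp (- l)"
      "8 * (real m)\<^sup>2 * (3 * real m) ^ (2 * m) \<le> exp (- l) * exp (exp (l * (1 + 16 * \<beta>)))"
      using exists_number_of_nodes[of D l \<beta> \<delta>] D False \<beta> by (auto simp: \<delta>_def)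
    define K where "K = 8 * (real m)\<^sup>2 * (3 * real m) ^ (2 * m)"
    have K0: "0 \<le> K" by (simp add: K_def)
    define Q where "Q = 2 * B * \<epsilon> + K * N / (V * (r / 2) ^ ?n)"
    have Q: "U x \<le> Q" if x: "norm (x - x') \<le> L" for x
    proof -
      have "norm (y - x) \<le> \<Lambda>" if y: "y \<in> ball x0 (r / 2)" for y
      proof -
        have "norm (y - x) = norm ((y - x0) + (x0 - x') - (x - x'))" by simp
        then have "norm (y - x) \<le> norm (y - x0) + norm (x0 - x') + norm (x - x')"
          using norm_triangle_ineq4[of "(y - x0) + (x0 - x')" "x - x'"] norm_triangle_ineq[of "y - x0" "x0 - x'"] by linarith
        moreover have "norm (y - x0) < r / 2" using y by (simp add: dist_norm norm_minus_commute)
        ultimately show ?thesis using x r unfolding \<Lambda>_def by linarith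
      qed
      from U_pw[OF m(1) \<Lambda> this]
      have "U x \<le> 2 * B * exp (- (2 * real m * \<delta>)) + K * N / (V * (r / 2) ^ ?n)"
        unfolding \<delta>_def K_def .
      moreover have "2 * B * exp (- (2 * real m * \<delta>)) \<le> 2 * B * \<epsilon>"
        using m(2) B0 unfolding \<epsilon>'(3) by (intro mult_left_mono) auto
      ultimately show ?thesis unfolding Q_def by linarith
    qed
    have Q0: "0 \<le> Q" using B0 \<epsilon>' K0 N V r by (simp add: Q_def)
    have "I \<le> E0 / b ^ ?n * (Q + 2 ^ ?n * exp (- b * L / 2) * B)"
      by (rule weighted[OF Q0 Q])
    also have "\<dots> = (2 + 2 ^ ?n) * E0\<^sup>2 * (1 / (b ^ ?n * R ^ ?n)) * (\<epsilon> * M)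
        + 2 ^ ?n * (E0 / V) * (1 / (b ^ ?n * r ^ ?n)) * (K * N)"
      using b R r V unfolding L(2) \<epsilon>'(3)[symmetric]
      by (simp add: Q_def B_def power2_eq_square power_divide field_simps)
    also have "\<dots> \<le> 2 ^ ?n * (3 * E0\<^sup>2) * \<beta> ^ ?n * (\<epsilon> * M) + 2 ^ ?n * (E0 / V) * \<beta> ^ ?n * (K * N)"
    proof (intro add_mono)
      have "2 + 2 ^ ?n \<le> 2 ^ ?n * (3::real)"
        using one_le_power[of "2::real" ?n] by linarith
      then have "(2 + 2 ^ ?n) * E0\<^sup>2 \<le> 2 ^ ?n * (3 * E0\<^sup>2)"
        using mult_right_mono[of "2 + 2 ^ ?n" "2 ^ ?n * (3::real)" "E0\<^sup>2"] by (simp add: mult.assoc)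
      then show "(2 + 2 ^ ?n) * E0\<^sup>2 * (1 / (b ^ ?n * R ^ ?n)) * (\<epsilon> * M) \<le> 2 ^ ?n * (3 * E0\<^sup>2) * \<beta> ^ ?n * (\<epsilon> * M)"
        unfolding bR using \<beta> \<epsilon>' M by (intro mult_right_mono) auto
      show "2 ^ ?n * (E0 / V) * (1 / (b ^ ?n * r ^ ?n)) * (K * N) \<le> 2 ^ ?n * (E0 / V) * \<beta> ^ ?n * (K * N)"
        using br E0 V K0 N by (intro mult_right_mono mult_left_mono) auto
    qed
    also have "\<dots> \<le> P * \<beta> ^ ?n * (\<epsilon> * M + K * N)"
    proof -
      have "0 \<le> 2 ^ ?n * (E0 / V) * \<beta> ^ ?n * (\<epsilon> * M)" "0 \<le> 2 ^ ?n * (3 * E0\<^sup>2) * \<beta> ^ ?n * (K * N)"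
        using E0 V \<beta> \<epsilon>' M K0 N by (auto intro!: mult_nonneg_nonneg)
      moreover have "P = 2 ^ ?n * (3 * E0\<^sup>2) + 2 ^ ?n * (E0 / V)" unfolding P_def by (rule distrib_left)
      ultimately show ?thesis by (simp only: distrib_left[of _ "\<epsilon> * M"] distrib_right)
    qed
    also have "\<dots> \<le> exp (C * D) * (\<epsilon> * M + \<epsilon> * exp (\<epsilon> powr (- 1 - C * inverse b / R)) * N)"
    proof (rule mult_mono)
      have "exp ((C - 64) * D) \<le> exp (C * D)"
        using D(1) by (simp add: mult_right_mono)
      with pre show "P * \<beta> ^ ?n \<le> exp (C * D)" by linarith
      have "16 * \<beta> \<le> C * \<beta>" using \<beta> P by (intro mult_right_mono) (auto simp: C_def)
      then have "l * (1 + 16 * \<beta>) \<le> l * (1 + C * \<beta>)" using \<epsilon>' by (intro mult_left_mono) auto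
      also have "exp (l * (1 + C * \<beta>)) = \<epsilon> powr (- 1 - C * inverse b / R)"
        using \<epsilon>'(1) by (simp add: powr_def l_def \<beta>_def algebra_simps)
      finally have "exp (l * (1 + 16 * \<beta>)) \<le> \<epsilon> powr (- 1 - C * inverse b / R)" by simp
      then have "K \<le> \<epsilon> * exp (\<epsilon> powr (- 1 - C * inverse b / R))"
        using m(3) unfolding K_def \<epsilon>'(3)[symmetric]
        by (meson order_trans mult_left_mono exp_le_cancel_iff less_imp_le[OF \<epsilon>'(1)])
      then show "\<epsilon> * M + K * N \<le> \<epsilon> * M + \<epsilon> * exp (\<epsilon> powr (- 1 - C * inverse b / R)) * N"
        using N by (intro add_left_mono mult_right_mono)
    qed (use \<epsilon>' M K0 N in auto)
    finally show ?thesis .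
  qed
  then show ?thesis unfolding I_def D_def N_def M_def U_def .
qed

theorem theorem1p5:
  shows "\<exists>C > (0::real).
    \<forall>(x\<^sub>0 :: real ^ 'n) (x' :: real ^ 'n) (r::real) (a::real) (b::real) (T::real)
      (u\<^sub>0 :: real ^ 'n \<Rightarrow> complex) (\<epsilon>::real).
      r > 0 \<longrightarrow> a > 0 \<longrightarrow> b > 0 \<longrightarrow> T > 0 \<longrightarrow>
      smooth_compact_support u\<^sub>0 \<longrightarrow> \<epsilon> \<in> {0<..<1} \<longrightarrow>
      (LINT x|lborel. exp (- b * norm (x - x')) * (cmod (schrodinger_evolution u\<^sub>0 x T))\<^sup>2)
      \<le> exp (C * (1 + (norm (x\<^sub>0 - x') + r + inverse b) / min (a * T) r)) *
        (\<epsilon> * (LINT x|lborel. exp (a * norm x) * (cmod (u\<^sub>0 x))\<^sup>2) +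
         \<epsilon> * exp (\<epsilon> powr (- 1 - C * inverse b / min (a * T) r)) *
           (LINT x:cball x\<^sub>0 r|lborel. (cmod (schrodinger_evolution u\<^sub>0 x T))\<^sup>2))"
proof -
  let ?E = "LINT y::real^'n|lborel. exp (- norm y)"
  have "0 \<le> ?E" by simp
  then have "0 < 65 + real CARD('n) + 2 ^ CARD('n) * (3 * ?E\<^sup>2 + ?E / unit_ball_vol (real CARD('n)))"
    by (intro add_pos_nonneg) auto
  then show ?thesis using observability_at_one_time by blast
qed

end
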